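(* Let $n\ge 3$ and let $(M^n,g,f)$ be a steady gradient Ricci soliton, i.e. $g$ is a Riemannian metric on the smooth manifold $M^n$ and $f$ is a smooth function on $M$ with $Ric = Hess\, f$, normalized so that $R+|\nabla f|^2=1$, where $R$ is the scalar curvature. Then, at the points where $R<1$, $$(1-R)^{3/2}\,\mathrm{div}\left(\frac{\nabla R}{\sqrt{1-R}}-2\sqrt{1-R}\,\nabla f\right)=-(n-2)^{2}|D|^{2} - \frac{|\nabla R + 2R\nabla f|^{2}}{2(n-1)}-2R(1-R)^{2}.$$
   Context: The $D$-tensor is the $3$-tensor $$D_{ijk} = \frac{1}{n-2}(R_{ik}\nabla_{j}f - R_{jk}\nabla_{i}f) + \frac{1}{2(n-1)(n-2)}\left[g_{jk}(\nabla_{i}R+2R\nabla_{i}f)-g_{ik}(\nabla_{j}R+2R\nabla_{j}f)\right],$$ where $R_{ij}$ are the components of the Ricci tensor $Ric$, and $|D|^2$ is its full squared norm with respect to $g$ (sum over all $i,j,k$ in an orthonormal frame). On a (connected) steady gradient Ricci soliton $R+|\nabla f|^2$ is constant, and the paper's standing normalization is that this constant is $1$. *)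

theory Defs
  imports "HOL-Analysis.Analysis"
begin

text \<open>
  A smooth n-manifold is a topology together with a smooth atlas of charts into \<open>real ^ 'n\<close>, where
  n is \<open>CARD('n)\<close>.  Tensor fields are given by their components in the charts of the atlas, and
  all tensor operations by the classical coordinate formulas.
\<close>

subsection \<open>Smooth functions on open subsets of Euclidean space\<close>

definition pd :: "'n::finite \<Rightarrow> (real ^ 'n \<Rightarrow> real) \<Rightarrow> real ^ 'n \<Rightarrow> real" where
  "pd i u x = frechet_derivative u (at x) (axis i 1)"

text \<open>\<open>Ck_on k S u\<close> is only meant for open \<open>S\<close>.\<close>

primrec Ck_on :: "nat \<Rightarrow> (real ^ 'n::finite) set \<Rightarrow> (real ^ 'n \<Rightarrow> real) \<Rightarrow> bool" where
  "Ck_on 0 S u \<longleftrightarrow> continuous_on S u"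
| "Ck_on (Suc k) S u \<longleftrightarrow> (\<forall>x\<in>S. u differentiable (at x)) \<and> (\<forall>i. Ck_on k S (pd i u))"

definition smooth_on :: "(real ^ 'n::finite) set \<Rightarrow> (real ^ 'n \<Rightarrow> real) \<Rightarrow> bool" where
  "smooth_on S u \<longleftrightarrow> (\<forall>k. Ck_on k S u)"


subsection \<open>Smooth manifolds\<close>

text \<open>A chart \<open>(U, \<phi>)\<close>; the values of \<open>\<phi>\<close> outside \<open>U\<close> are irrelevant.\<close>

type_synonym ('m, 'n) chart = "'m set \<times> ('m \<Rightarrow> real ^ 'n)"

definition chart_image :: "('m, 'n::finite) chart \<Rightarrow> (real ^ 'n) set" where
  "chart_image c = snd c ` fst c"

definition coord_rep :: "('m, 'n::finite) chart \<Rightarrow> ('m \<Rightarrow> 'b) \<Rightarrow> real ^ 'n \<Rightarrow> 'b" where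
  "coord_rep c h = h \<circ> inv_into (fst c) (snd c)"

definition overlap :: "('m, 'n::finite) chart \<Rightarrow> ('m, 'n) chart \<Rightarrow> (real ^ 'n) set" where
  "overlap c d = snd c ` (fst c \<inter> fst d)"

definition transition :: "('m, 'n::finite) chart \<Rightarrow> ('m, 'n) chart \<Rightarrow> real ^ 'n \<Rightarrow> real ^ 'n" where
  "transition c d = coord_rep c (snd d)"

text \<open>The atlas is not required to be maximal.\<close>

definition smooth_manifold :: "'m topology \<Rightarrow> ('m, 'n::finite) chart set \<Rightarrow> bool" where
  "smooth_manifold X A \<longleftrightarrow>
     Hausdorff_space X \<and> second_countable X \<and>
     (\<Union>c\<in>A. fst c) = topspace X \<and>
     (\<forall>c\<in>A. openin X (fst c) \<and> open (chart_image c) \<and>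
        homeomorphic_map (subtopology X (fst c)) (top_of_set (chart_image c)) (snd c)) \<and>
     (\<forall>c\<in>A. \<forall>d\<in>A. \<forall>a. smooth_on (overlap c d) (\<lambda>x. transition c d x $ a))"

definition smooth_function :: "('m, 'n::finite) chart set \<Rightarrow> ('m \<Rightarrow> real) \<Rightarrow> bool" where
  "smooth_function A f \<longleftrightarrow> (\<forall>c\<in>A. smooth_on (chart_image c) (coord_rep c f))"


subsection \<open>Riemannian metrics\<close>

text \<open>
  \<open>g c x $ i $ j\<close> is the component \<open>g\<^sub>i\<^sub>j\<close> in the chart \<open>c\<close> at the point with
  coordinates \<open>x\<close>.  The last conjunct is the transformation law of a covariant 2-tensor.
\<close>

type_synonym ('m, 'n) metric_field = "('m, 'n) chart \<Rightarrow> real ^ 'n \<Rightarrow> real ^ 'n ^ 'n"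

definition riemannian_metric ::
    "('m, 'n::finite) chart set \<Rightarrow> ('m, 'n) metric_field \<Rightarrow> bool" where
  "riemannian_metric A g \<longleftrightarrow>
     (\<forall>c\<in>A. \<forall>i j. smooth_on (chart_image c) (\<lambda>x. g c x $ i $ j)) \<and>
     (\<forall>c\<in>A. \<forall>x\<in>chart_image c. transpose (g c x) = g c x) \<and>
     (\<forall>c\<in>A. \<forall>x\<in>chart_image c. \<forall>v. v \<noteq> 0 \<longrightarrow> v \<bullet> (g c x *v v) > 0) \<and>
     (\<forall>c\<in>A. \<forall>d\<in>A. \<forall>x\<in>overlap c d. \<forall>i j.
        g c x $ i $ j =
        (\<Sum>a\<in>UNIV. \<Sum>b\<in>UNIV. pd i (\<lambda>y. transition c d y $ a) x *
           pd j (\<lambda>y. transition c d y $ b) x * g d (transition c d x) $ a $ b))"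


subsection \<open>Riemannian geometry in a chart\<close>

text \<open>In this section \<open>G\<close> is the coordinate expression of a metric in one chart.\<close>

definition ginv :: "(real ^ 'n::finite \<Rightarrow> real ^ 'n ^ 'n) \<Rightarrow> real ^ 'n \<Rightarrow> real ^ 'n ^ 'n" where
  "ginv G x = matrix_inv (G x)"

text \<open>\<open>christoffel G k i j\<close> is \<open>\<Gamma>\<^sup>k\<^sub>i\<^sub>j\<close> of the Levi-Civita connection.\<close>

definition christoffel ::
    "(real ^ 'n::finite \<Rightarrow> real ^ 'n ^ 'n) \<Rightarrow> 'n \<Rightarrow> 'n \<Rightarrow> 'n \<Rightarrow> real ^ 'n \<Rightarrow> real" where
  "christoffel G k i j x = (1/2) * (\<Sum>l\<in>UNIV. ginv G x $ k $ l *
     (pd i (\<lambda>y. G y $ j $ l) x + pd j (\<lambda>y. G y $ i $ l) x - pd l (\<lambda>y. G y $ i $ j) x))"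

text \<open>
  \<open>riemann G l i j k\<close> is the \<open>l\<close>-th component of
  \<open>R(\<partial>\<^sub>i, \<partial>\<^sub>j) \<partial>\<^sub>k = \<nabla>\<^sub>i \<nabla>\<^sub>j \<partial>\<^sub>k - \<nabla>\<^sub>j \<nabla>\<^sub>i \<partial>\<^sub>k\<close>;
  with the contraction below, round spheres have positive Ricci curvature.
\<close>

definition riemann ::
    "(real ^ 'n::finite \<Rightarrow> real ^ 'n ^ 'n) \<Rightarrow> 'n \<Rightarrow> 'n \<Rightarrow> 'n \<Rightarrow> 'n \<Rightarrow> real ^ 'n \<Rightarrow> real" where
  "riemann G l i j k x =
     pd i (christoffel G l j k) x - pd j (christoffel G l i k) x +
     (\<Sum>m\<in>UNIV. christoffel G l i m x * christoffel G m j k x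
                 - christoffel G l j m x * christoffel G m i k x)"

definition ricci ::
    "(real ^ 'n::finite \<Rightarrow> real ^ 'n ^ 'n) \<Rightarrow> 'n \<Rightarrow> 'n \<Rightarrow> real ^ 'n \<Rightarrow> real" where
  "ricci G j k x = (\<Sum>i\<in>UNIV. riemann G i i j k x)"

definition scalar_curvature ::
    "(real ^ 'n::finite \<Rightarrow> real ^ 'n ^ 'n) \<Rightarrow> real ^ 'n \<Rightarrow> real" where
  "scalar_curvature G x = (\<Sum>i\<in>UNIV. \<Sum>j\<in>UNIV. ginv G x $ i $ j * ricci G i j x)"

definition hessian ::
    "(real ^ 'n::finite \<Rightarrow> real ^ 'n ^ 'n) \<Rightarrow> (real ^ 'n \<Rightarrow> real) \<Rightarrow> 'n \<Rightarrow> 'n \<Rightarrow> real ^ 'n \<Rightarrow> real" where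
  "hessian G u i j x = pd i (pd j u) x - (\<Sum>k\<in>UNIV. christoffel G k i j x * pd k u x)"

definition grad ::
    "(real ^ 'n::finite \<Rightarrow> real ^ 'n ^ 'n) \<Rightarrow> (real ^ 'n \<Rightarrow> real) \<Rightarrow> real ^ 'n \<Rightarrow> real ^ 'n" where
  "grad G u x = (\<chi> i. \<Sum>j\<in>UNIV. ginv G x $ i $ j * pd j u x)"

definition divergence ::
    "(real ^ 'n::finite \<Rightarrow> real ^ 'n ^ 'n) \<Rightarrow> (real ^ 'n \<Rightarrow> real ^ 'n) \<Rightarrow> real ^ 'n \<Rightarrow> real" where
  "divergence G V x =
     (\<Sum>i\<in>UNIV. pd i (\<lambda>y. V y $ i) x + (\<Sum>j\<in>UNIV. christoffel G i i j x * V x $ j))"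

definition vec_norm_sq ::
    "(real ^ 'n::finite \<Rightarrow> real ^ 'n ^ 'n) \<Rightarrow> real ^ 'n \<Rightarrow> real ^ 'n \<Rightarrow> real" where
  "vec_norm_sq G x v = v \<bullet> (G x *v v)"

text \<open>The squared norm \<open>g\<^sup>i\<^sup>a g\<^sup>j\<^sup>b g\<^sup>k\<^sup>c T\<^sub>i\<^sub>j\<^sub>k T\<^sub>a\<^sub>b\<^sub>c\<close> of a covariant 3-tensor at \<open>x\<close>.\<close>

definition tensor3_norm_sq ::
    "(real ^ 'n::finite \<Rightarrow> real ^ 'n ^ 'n) \<Rightarrow> real ^ 'n \<Rightarrow> ('n \<Rightarrow> 'n \<Rightarrow> 'n \<Rightarrow> real) \<Rightarrow> real" where
  "tensor3_norm_sq G x T =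
     (\<Sum>i\<in>UNIV. \<Sum>j\<in>UNIV. \<Sum>k\<in>UNIV. \<Sum>a\<in>UNIV. \<Sum>b\<in>UNIV. \<Sum>c\<in>UNIV.
        ginv G x $ i $ a * ginv G x $ j $ b * ginv G x $ k $ c * T i j k * T a b c)"

definition D_tensor ::
    "(real ^ 'n::finite \<Rightarrow> real ^ 'n ^ 'n) \<Rightarrow> (real ^ 'n \<Rightarrow> real) \<Rightarrow> real ^ 'n
      \<Rightarrow> 'n \<Rightarrow> 'n \<Rightarrow> 'n \<Rightarrow> real" where
  "D_tensor G u x i j k =
     (let n = real CARD('n); R = scalar_curvature G in
        1 / (n - 2) * (ricci G i k x * pd j u x - ricci G j k x * pd i u x) +
        1 / (2 * (n - 1) * (n - 2)) *
          (G x $ j $ k * (pd i R x + 2 * R x * pd i u x)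
           - G x $ i $ k * (pd j R x + 2 * R x * pd j u x)))"


subsection \<open>Squared norms in orthonormal frames\<close>

lemma ginv_orthonormal_frame:
  fixes E :: "'n::finite \<Rightarrow> real ^ 'n"
  assumes "\<And>a b. E a \<bullet> (G x *v E b) = (if a = b then 1 else 0)"
  shows "ginv G x $ i $ j = (\<Sum>a\<in>UNIV. E a $ i * E a $ j)"
proof -
  define P :: "real ^ 'n ^ 'n" where "P = (\<chi> i a. E a $ i)"
  have PE: "P *v axis b 1 = E b" for b
    by (simp add: P_def vec_eq_iff matrix_vector_mult_basis column_def)
  have "(transpose P ** G x ** P) $ a $ b = mat 1 $ a $ b" for a b
  proof -
    have "(transpose P ** G x ** P) $ a $ b = axis a 1 \<bullet> ((transpose P ** G x ** P) *v axis b 1)"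
      by (simp add: matrix_vector_mult_basis column_def inner_axis')
    also have "\<dots> = (P *v axis a 1) \<bullet> (G x *v (P *v axis b 1))"
      by (simp add: matrix_vector_mul_assoc[symmetric] dot_lmul_matrix)
        (metis dot_lmul_matrix inner_commute transpose_matrix_vector)
    finally show ?thesis
      using assms by (simp add: PE mat_def)
  qed
  then have I: "transpose P ** G x ** P = mat 1"
    by (simp add: vec_eq_iff)
  then have "P ** (transpose P ** G x) = mat 1"
    using matrix_left_right_inverse by blast
  then have 1: "(P ** transpose P) ** G x = mat 1"
    by (simp add: matrix_mul_assoc)
  then have 2: "G x ** (P ** transpose P) = mat 1"
    using matrix_left_right_inverse by blast
  have "G x ** ginv G x = mat 1 \<and> ginv G x ** G x = mat 1"
    unfolding ginv_def matrix_inv_def by (rule someI2[where a = "P ** transpose P"]) (use 1 2 in auto)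
  then have "ginv G x = P ** transpose P"
    using 1 by (metis matrix_mul_assoc matrix_mul_lid matrix_mul_rid)
  then show ?thesis
    by (simp add: matrix_matrix_mult_def transpose_def P_def)
qed

theorem tensor3_norm_sq_orthonormal_frame:
  fixes E :: "'n::finite \<Rightarrow> real ^ 'n"
  assumes "\<And>a b. E a \<bullet> (G x *v E b) = (if a = b then 1 else 0)"
  shows "tensor3_norm_sq G x T =
    (\<Sum>a\<in>UNIV. \<Sum>b\<in>UNIV. \<Sum>c\<in>UNIV.
       (\<Sum>i\<in>UNIV. \<Sum>j\<in>UNIV. \<Sum>k\<in>UNIV. E a $ i * E b $ j * E c $ k * T i j k)\<^sup>2)"
proof -
  define e where "e = (\<lambda>(a, b, c) (i, j, k). E a $ i * E b $ j * E c $ k)"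
  define t where "t = (\<lambda>(i, j, k). T i j k)"
  have triple: "(\<Sum>i\<in>UNIV. \<Sum>j\<in>UNIV. \<Sum>k\<in>UNIV. h (i, j, k)) = sum h UNIV"
    for h :: "'n \<times> 'n \<times> 'n \<Rightarrow> real"
    by (simp add: sum.cartesian_product split_def flip: UNIV_Times_UNIV)
  have prod3: "sum f UNIV * (sum g UNIV * sum h UNIV) =
      (\<Sum>a\<in>UNIV. \<Sum>b\<in>UNIV. \<Sum>c\<in>UNIV. f a * (g b * h c))" for f g h :: "'n \<Rightarrow> real"
  proof -
    have "sum f UNIV * (sum g UNIV * sum h UNIV)
        = (\<Sum>a\<in>UNIV. f a * (\<Sum>b\<in>UNIV. g b * sum h UNIV))"
      by (simp only: sum_distrib_right)
    then show ?thesis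
      by (simp only: sum_distrib_left)
  qed
  have frame: "ginv G x $ i $ j = (\<Sum>a\<in>UNIV. E a $ i * E a $ j)" for i j
    using assms by (rule ginv_orthonormal_frame)
  have ginv_e: "ginv G x $ i $ l * ginv G x $ j $ m * ginv G x $ k $ n
      = (\<Sum>r\<in>UNIV. e r (i, j, k) * e r (l, m, n))" for i j k l m n
    unfolding triple[symmetric] frame mult.assoc prod3 e_def prod.case
    by (intro sum.cong refl) (simp only: mult_ac)
  have "tensor3_norm_sq G x T = (\<Sum>p\<in>UNIV. \<Sum>q\<in>UNIV. (\<Sum>r\<in>UNIV. e r p * e r q) * t p * t q)"
    unfolding tensor3_norm_sq_def ginv_e triple[symmetric] t_def by simp
  also have "\<dots> = (\<Sum>p\<in>UNIV. \<Sum>q\<in>UNIV. \<Sum>r\<in>UNIV. (e r p * t p) * (e r q * t q))"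
    by (simp add: sum_distrib_left mult_ac)
  also have "\<dots> = (\<Sum>p\<in>UNIV. \<Sum>r\<in>UNIV. \<Sum>q\<in>UNIV. (e r p * t p) * (e r q * t q))"
    by (intro sum.cong refl sum.swap)
  also have "\<dots> = (\<Sum>r\<in>UNIV. \<Sum>p\<in>UNIV. \<Sum>q\<in>UNIV. (e r p * t p) * (e r q * t q))"
    by (rule sum.swap)
  also have "\<dots> = (\<Sum>r\<in>UNIV. (\<Sum>p\<in>UNIV. e r p * t p)\<^sup>2)"
    by (simp add: power2_eq_square sum_product)
  finally show ?thesis
    unfolding triple[symmetric] by (simp add: e_def t_def)
qed

end

(*
Everything is local, so one chart suffices. Write u for f and H for the covariant derivative of grad u,
i.e. the Ricci tensor with an index raised. Differentiating R + |grad u|^2 = 1 gives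
dR = -2 Ric(grad u). The contracted Ricci identity for grad u then yields div H = dR / 2, hence
  div grad R = - <dR, du> - 2 |Ric|^2,
and the product rule gives
  (1 - R)^(3/2) div V = -2 (1 - R) |Ric|^2 + |dR|^2 / 2 - 2 R (1 - R)^2.
Put w = dR + 2 R du and k = 1 / (2 (n - 1)). Then (n - 2) D is the alternation in i, j of
Ric_ik u_j - k g_ik w_j; expanding its norm with |du|^2 = 1 - R and dR = -2 Ric(grad u) gives
  (n - 2)^2 |D|^2 = 2 (1 - R) |Ric|^2 - |dR|^2 / 2 - k |w|^2.
*)

theory Submission
  imports Defs
begin

subsection \<open>Partial derivatives\<close>

text \<open>The obstacle is regularity. \<open>R\<close> already contains two derivatives of the
  metric and its Laplacian takes two more, mixed with derivatives of the inverse metric. The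
  curvature formulas are therefore never differentiated a second time: on the whole chart image
  \<open>R\<close> equals \<open>1 - u^i u_i\<close>, it also equals the trace of \<open>H\<close>,
  and its gradient equals \<open>-2 H(grad u)\<close>. These identities hold on an open set, so
  derivatives may be taken of their other sides. First-order differentiability of the inverse metric
  and of the Christoffel symbols then suffices, and no formula for a derivative of the inverse
  metric occurs. The mixed type of \<open>H\<close> serves the same end: applying it to
  \<open>grad u\<close> and taking its divergence involves the connection but no raising of indices.

  The formula for div H arises as follows. The Ricci identity reads div H = d(div grad u) + Ric(grad
  u). Here div grad u = \<open>R\<close> is the trace of the soliton equation and Ric(grad u) =
  -dR/2, so dR/2 remains.\<close>

lemma pd_eqI: "(f has_derivative f') (at x) \<Longrightarrow> pd i f x = f' (axis i 1)"
  unfolding pd_def using frechet_derivative_at by metis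

lemma has_derivative_frechet:
  "f differentiable (at x) \<Longrightarrow> (f has_derivative frechet_derivative f (at x)) (at x)"
  using frechet_derivative_works by blast

lemma pd_const [simp]: "pd i (\<lambda>y. c) x = 0"
  by (rule pd_eqI[where f'="\<lambda>_. 0"]) simp

lemma pd_add:
  "f differentiable (at x) \<Longrightarrow> h differentiable (at x) \<Longrightarrow>
    pd i (\<lambda>y. f y + h y) x = pd i f x + pd i h x"
  by (subst pd_eqI[OF has_derivative_add[OF has_derivative_frechet has_derivative_frechet]])
    (simp_all add: pd_def)

lemma pd_diff:
  "f differentiable (at x) \<Longrightarrow> h differentiable (at x) \<Longrightarrow>
    pd i (\<lambda>y. f y - h y) x = pd i f x - pd i h x"
  by (subst pd_eqI[OF has_derivative_diff[OF has_derivative_frechet has_derivative_frechet]])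
    (simp_all add: pd_def)

lemma pd_mult:
  "f differentiable (at x) \<Longrightarrow> h differentiable (at x) \<Longrightarrow>
    pd i (\<lambda>y. f y * h y) x = pd i f x * h x + f x * pd i h x"
  by (subst pd_eqI[OF has_derivative_mult[OF has_derivative_frechet has_derivative_frechet]])
    (simp_all add: pd_def)

lemma pd_cmult: "f differentiable (at x) \<Longrightarrow> pd i (\<lambda>y. c * f y) x = c * pd i f x"
  by (simp add: pd_mult)

lemma pd_sum:
  assumes "\<And>a. a \<in> S \<Longrightarrow> f a differentiable (at x)"
  shows "pd i (\<lambda>y. \<Sum>a\<in>S. f a y) x = (\<Sum>a\<in>S. pd i (f a) x)"
  by (subst pd_eqI[OF has_derivative_sum[OF has_derivative_frechet[OF assms]]])
    (simp_all add: pd_def)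

text \<open>Functions that agree near \<open>x\<close> have the same derivatives there, so the
  choice operator inside \<open>frechet_derivative\<close> picks the same one, even if there is
  none. This transfers identities valid on a chart image to their partial derivatives.\<close>

lemma pd_cong:
  assumes "open S" "x \<in> S" "\<And>y. y \<in> S \<Longrightarrow> f y = h y"
  shows "pd i f x = pd i h x"
proof -
  have "(f has_derivative f') (at x) \<longleftrightarrow> (h has_derivative f') (at x)" for f'
    using has_derivative_transform_within_open[OF _ assms(1,2)] assms(3) by metis
  then show ?thesis
    by (simp add: pd_def frechet_derivative_def)
qed

lemma differentiable_cong:
  assumes "open S" "x \<in> S" "\<And>y. y \<in> S \<Longrightarrow> f y = h y" "h differentiable (at x)"
  shows "f differentiable (at x)"
  using has_derivative_transform_within_open[OF _ assms(1,2)] assms(3,4)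
  unfolding differentiable_def by metis

lemma DERIV_differentiable:
  fixes f :: "real ^ 'n \<Rightarrow> real"
  assumes "(h has_field_derivative h') (at (f x))" "f differentiable (at x)"
  shows "(\<lambda>y. h (f y)) differentiable (at x)"
  using has_derivative_compose[OF has_derivative_frechet[OF assms(2)] assms(1)[unfolded has_field_derivative_def]]
  unfolding differentiable_def by auto

lemma pd_chain:
  fixes f :: "real ^ 'n::finite \<Rightarrow> real"
  assumes "(h has_field_derivative h') (at (f x))" "f differentiable (at x)"
  shows "pd i (\<lambda>y. h (f y)) x = h' * pd i f x"
  by (subst pd_eqI[OF has_derivative_compose[OF has_derivative_frechet[OF assms(2)]
        assms(1)[unfolded has_field_derivative_def]]]) (simp add: pd_def)

section \<open>Symmetry of second partial derivatives\<close>

lemma DERIV_along_axis: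
  fixes f :: "real ^ 'n::finite \<Rightarrow> real"
  assumes "f differentiable (at (z + s *\<^sub>R axis i 1))"
  shows "((\<lambda>s. f (z + s *\<^sub>R axis i 1)) has_real_derivative pd i f (z + s *\<^sub>R axis i 1)) (at s)"
proof -
  have "((\<lambda>s. z + s *\<^sub>R axis i 1) has_derivative (\<lambda>s. s *\<^sub>R axis i 1)) (at s)"
    by (auto intro!: derivative_eq_intros)
  from has_derivative_compose[OF this has_derivative_frechet[OF assms]]
  have "((\<lambda>s. f (z + s *\<^sub>R axis i 1)) has_derivative
     (\<lambda>t. frechet_derivative f (at (z + s *\<^sub>R axis i 1)) (t *\<^sub>R axis i 1))) (at s)" .
  moreover have "frechet_derivative f (at (z + s *\<^sub>R axis i 1)) (t *\<^sub>R axis i 1)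
      = pd i f (z + s *\<^sub>R axis i 1) * t" for t
    using linear_frechet_derivative[OF assms] by (simp add: pd_def linear_cmul)
  ultimately show ?thesis
    by (simp add: has_field_derivative_def)
qed

text \<open>The mean value theorem in direction \<open>i\<close> turns the second difference into
  \<open>t\<close> times a first difference of \<open>pd i f\<close>; linearizing
  \<open>pd i f\<close> at \<open>x\<close> then leaves its derivative in direction
  \<open>j\<close>.\<close>

lemma second_difference_tendsto:
  fixes f :: "real ^ 'n::finite \<Rightarrow> real"
  assumes "open S" "x \<in> S" and diff: "\<And>y. y \<in> S \<Longrightarrow> f differentiable (at y)"
    and "pd i f differentiable (at x)"
  shows "((\<lambda>t. (f (x + t *\<^sub>R axis i 1 + t *\<^sub>R axis j 1) - f (x + t *\<^sub>R axis i 1)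
            - f (x + t *\<^sub>R axis j 1) + f x) / t\<^sup>2) \<longlongrightarrow> pd j (pd i f) x) (at_right 0)"
proof (rule tendstoI)
  fix e :: real assume "e > 0"
  define L where "L = frechet_derivative (pd i f) (at x)"
  have L: "(pd i f has_derivative L) (at x)"
    unfolding L_def by (rule has_derivative_frechet) fact
  have lin: "linear L"
    using L has_derivative_linear by blast
  \<comment> \<open>The two points compared below lie within \<open>2 * t\<close> and
    \<open>t\<close> of \<open>x\<close>, so the linearization errors add up to at most
    \<open>e/6 * (3 * t)\<close>, half of the tolerance \<open>e * t\<close>.\<close>
  obtain d where "d > 0" and d: "\<And>y. norm (y - x) < d \<Longrightarrow>
      norm (pd i f y - pd i f x - L (y - x)) \<le> e/6 * norm (y - x)"
    using L \<open>e > 0\<close> unfolding has_derivative_at_alt by (metis divide_pos_pos zero_less_numeral)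
  obtain r where "r > 0" and r: "\<And>y. norm (y - x) < r \<Longrightarrow> y \<in> S"
    using assms(1,2) by (metis open_dist dist_norm)
  have "dist ((f (x + t *\<^sub>R axis i 1 + t *\<^sub>R axis j 1) - f (x + t *\<^sub>R axis i 1)
            - f (x + t *\<^sub>R axis j 1) + f x) / t\<^sup>2) (pd j (pd i f) x) < e"
    if t: "0 < t" "t < min (d/2) (r/2)" for t
  proof -
    \<comment> \<open>\<open>\<phi>\<close> compares \<open>f\<close> on two parallel segments in
      direction \<open>i\<close>, offset by \<open>t\<close> in direction \<open>j\<close>; its
      increment over \<open>[0, t]\<close> is the second difference.\<close>
    define z where "z = x + t *\<^sub>R axis j 1"
    define \<phi> where "\<phi> s = f (z + s *\<^sub>R axis i 1) - f (x + s *\<^sub>R axis i 1)" for s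
    have n1: "norm (x + s *\<^sub>R axis i 1 - x) \<le> t" if "0 \<le> s" "s \<le> t" for s
      using that by simp
    have n2: "norm (z + s *\<^sub>R axis i 1 - x) \<le> 2 * t" if "0 \<le> s" "s \<le> t" for s
    proof -
      have "norm (t *\<^sub>R axis j 1 + s *\<^sub>R axis i (1::real)) \<le> t + s"
        by (rule order_trans[OF norm_triangle_ineq]) (use that t in simp)
      then show ?thesis
        using that by (simp add: z_def algebra_simps)
    qed
    have der: "(\<phi> has_real_derivative pd i f (z + s *\<^sub>R axis i 1) - pd i f (x + s *\<^sub>R axis i 1)) (at s)"
      if "0 \<le> s" "s \<le> t" for s
      unfolding \<phi>_def
      by (intro DERIV_diff DERIV_along_axis diff r)
        (use n1[OF that] n2[OF that] t in linarith)+
    obtain s where s: "0 < s" "s < t" and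
      \<phi>s: "\<phi> t - \<phi> 0 = (t - 0) * (pd i f (z + s *\<^sub>R axis i 1) - pd i f (x + s *\<^sub>R axis i 1))"
      using MVT2[OF t(1) der] by blast
    let ?A = "pd i f (z + s *\<^sub>R axis i 1) - pd i f x - L (z + s *\<^sub>R axis i 1 - x)"
    let ?B = "pd i f (x + s *\<^sub>R axis i 1) - pd i f x - L (x + s *\<^sub>R axis i 1 - x)"
    have "\<bar>?A\<bar> \<le> e/6 * norm (z + s *\<^sub>R axis i 1 - x)"
      using d[of "z + s *\<^sub>R axis i 1"] n2[of s] s t by simp
    also have "\<dots> \<le> e/6 * (2 * t)"
      using n2[of s] s \<open>e > 0\<close> by (intro mult_left_mono) auto
    finally have "\<bar>?A\<bar> \<le> e/6 * (2 * t)" .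
    moreover have "\<bar>?B\<bar> \<le> e/6 * norm (x + s *\<^sub>R axis i 1 - x)"
      using d[of "x + s *\<^sub>R axis i 1"] n1[of s] s t by simp
    then have "\<bar>?B\<bar> \<le> e/6 * t"
      using n1[of s] s \<open>e > 0\<close> by (elim order_trans) (intro mult_left_mono, auto)
    moreover have "L (z + s *\<^sub>R axis i 1 - x) - L (x + s *\<^sub>R axis i 1 - x) = t * pd j (pd i f) x"
    proof -
      have "L (z + s *\<^sub>R axis i 1 - x) - L (x + s *\<^sub>R axis i 1 - x) = L (t *\<^sub>R axis j 1)"
        by (simp add: linear_diff[OF lin, symmetric] z_def)
      then show ?thesis
        by (simp add: linear_cmul[OF lin] pd_eqI[OF L])
    qed
    ultimately have "\<bar>pd i f (z + s *\<^sub>R axis i 1) - pd i f (x + s *\<^sub>R axis i 1) - t * pd j (pd i f) x\<bar>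
        \<le> e/2 * t"
      by linarith
    also have "\<dots> < e * t"
      using \<open>e > 0\<close> t by simp
    finally have "\<bar>(\<phi> t - \<phi> 0) / t - t * pd j (pd i f) x\<bar> < e * t"
      using t \<phi>s by simp
    then have "\<bar>(\<phi> t - \<phi> 0) / t - t * pd j (pd i f) x\<bar> / t < e"
      using t by (simp add: pos_divide_less_eq)
    moreover have "\<bar>(\<phi> t - \<phi> 0) / t - t * pd j (pd i f) x\<bar> / t
        = \<bar>(\<phi> t - \<phi> 0) / t\<^sup>2 - pd j (pd i f) x\<bar>"
    proof -
      have "((\<phi> t - \<phi> 0) / t - t * pd j (pd i f) x) / t = (\<phi> t - \<phi> 0) / t\<^sup>2 - pd j (pd i f) x"
        using t by (simp add: field_simps power2_eq_square)
      then show ?thesis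
        using t by (metis abs_divide abs_of_pos)
    qed
    moreover have "\<phi> t - \<phi> 0 = f (x + t *\<^sub>R axis i 1 + t *\<^sub>R axis j 1) - f (x + t *\<^sub>R axis i 1)
            - f (x + t *\<^sub>R axis j 1) + f x"
      by (simp add: \<phi>_def z_def add.commute add.left_commute)
    ultimately show ?thesis
      by (simp add: dist_real_def)
  qed
  then show "\<forall>\<^sub>F t in at_right 0. dist ((f (x + t *\<^sub>R axis i 1 + t *\<^sub>R axis j 1) - f (x + t *\<^sub>R axis i 1)
            - f (x + t *\<^sub>R axis j 1) + f x) / t\<^sup>2) (pd j (pd i f) x) < e"
    using \<open>d > 0\<close> \<open>r > 0\<close> by (intro eventually_at_rightI[of 0 "min (d/2) (r/2)"]) auto
qed

text \<open>The second difference quotient is symmetric in \<open>i\<close> and \<open>j\<close>,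
  and each iterated partial is its limit. This is Young's version, with first partials
  differentiable at the single point \<open>x\<close> in place of continuous second
  partials.\<close>

lemma pd_commute:
  fixes f :: "real ^ 'n::finite \<Rightarrow> real"
  assumes "open S" "x \<in> S" "\<And>y. y \<in> S \<Longrightarrow> f differentiable (at y)"
    and "\<And>i. pd i f differentiable (at x)"
  shows "pd i (pd j f) x = pd j (pd i f) x"
proof (rule tendsto_unique[OF trivial_limit_at_right_real])
  let ?F = "\<lambda>i j t. (f (x + t *\<^sub>R axis i 1 + t *\<^sub>R axis j 1) - f (x + t *\<^sub>R axis i 1)
            - f (x + t *\<^sub>R axis j 1) + f x) / t\<^sup>2"
  have sym: "?F i j = ?F j i"
    by (simp add: fun_eq_iff algebra_simps)
  show "(?F i j \<longlongrightarrow> pd j (pd i f) x) (at_right 0)"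
    by (rule second_difference_tendsto) (use assms in auto)
  show "(?F i j \<longlongrightarrow> pd i (pd j f) x) (at_right 0)"
    unfolding sym by (rule second_difference_tendsto) (use assms in auto)
qed

text \<open>By the Leibniz expansion the determinant is a polynomial in the entries; through
  Cramer's rule this controls the inverse metric.\<close>

lemma differentiable_det:
  fixes M :: "'a::real_normed_vector \<Rightarrow> real ^ 'n ^ 'n"
  assumes "\<And>i j. (\<lambda>y. M y $ i $ j) differentiable (at x)"
  shows "(\<lambda>y. det (M y)) differentiable (at x)"
proof -
  obtain D where D: "\<And>i j. ((\<lambda>y. M y $ i $ j) has_derivative D i j) (at x)"
    using assms unfolding differentiable_def by metis
  have "(\<lambda>y. \<Prod>i\<in>UNIV. M y $ i $ p i) differentiable (at x)" for p
    unfolding differentiable_def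
    using has_derivative_prod[where I = "UNIV :: 'n set" and f = "\<lambda>i y. M y $ i $ p i", OF D]
    by blast
  then show ?thesis
    unfolding det_def by simp
qed

lemma smooth_on_differentiable:
  assumes "smooth_on S f" "x \<in> S"
  shows "f differentiable (at x)"
  using assms unfolding smooth_on_def by (metis Ck_on.simps(2))

lemma smooth_on_pd: "smooth_on S f \<Longrightarrow> smooth_on S (pd i f)"
  unfolding smooth_on_def by (metis Ck_on.simps(2))

subsection \<open>Covariant derivatives in a chart\<close>

text \<open>Cancels a lowering of an index against a raising; \<open>P\<close> and \<open>Q\<close>
  will be the metric and its inverse, in either order.\<close>

lemma sum_kronecker_contract:
  fixes v :: "'n::finite \<Rightarrow> real"
  assumes "\<And>i k. (\<Sum>j\<in>UNIV. P i j * Q j k) = (if i = k then 1 else 0)"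
  shows "(\<Sum>j\<in>UNIV. P i j * (\<Sum>k\<in>UNIV. Q j k * v k)) = v i"
proof -
  have "(\<Sum>j\<in>UNIV. P i j * (\<Sum>k\<in>UNIV. Q j k * v k)) = (\<Sum>k\<in>UNIV. \<Sum>j\<in>UNIV. P i j * Q j k * v k)"
    by (subst sum.swap) (simp add: sum_distrib_left mult.assoc)
  also have "\<dots> = (\<Sum>k\<in>UNIV. if i = k then v k else 0)"
    by (simp add: sum_distrib_right[symmetric] assms if_distrib[where f="\<lambda>c. c * _"] cong: if_cong)
  finally show ?thesis
    by simp
qed

text \<open>\<open>cov G Z i j\<close> is \<open>\<nabla>\<^sub>j Z\<^sup>i\<close>: the upper index comes first.\<close>

definition cov :: "(real ^ 'n::finite \<Rightarrow> real ^ 'n ^ 'n) \<Rightarrow> (real ^ 'n \<Rightarrow> real ^ 'n)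
    \<Rightarrow> 'n \<Rightarrow> 'n \<Rightarrow> real ^ 'n \<Rightarrow> real" where
  "cov G Z i j y = pd j (\<lambda>z. Z z $ i) y + (\<Sum>l\<in>UNIV. christoffel G i j l y * Z y $ l)"

lemma divergence_eq_cov_trace: "divergence G Z x = (\<Sum>i\<in>UNIV. cov G Z i i x)"
  by (simp add: divergence_def cov_def)

locale riemannian_chart =
  fixes U :: "(real ^ 'n::finite) set" and G :: "real ^ 'n \<Rightarrow> real ^ 'n ^ 'n"
  assumes open_U: "open U"
    and smooth_G: "\<And>i j. smooth_on U (\<lambda>x. G x $ i $ j)"
    and transpose_G: "\<And>x. x \<in> U \<Longrightarrow> transpose (G x) = G x"
    and pos_G: "\<And>x v. x \<in> U \<Longrightarrow> v \<noteq> 0 \<Longrightarrow> v \<bullet> (G x *v v) > 0"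
begin

section \<open>Algebra and differentiability of the inverse metric\<close>

lemma G_sym: "x \<in> U \<Longrightarrow> G x $ i $ j = G x $ j $ i"
  using transpose_G[of x] by (metis transpose_def vec_lambda_beta)

lemma invertible_G:
  assumes "x \<in> U" shows "invertible (G x)"
proof -
  have "v = 0" if "G x *v v = 0" for v
    using pos_G[OF assms, of v] that by force
  then show ?thesis
    using matrix_left_invertible_ker invertible_left_inverse by blast
qed

lemma ginv_mult:
  assumes "x \<in> U" shows "G x ** ginv G x = mat 1" "ginv G x ** G x = mat 1"
proof -
  have "G x ** ginv G x = mat 1 \<and> ginv G x ** G x = mat 1"
    using invertible_G[OF assms] unfolding ginv_def matrix_inv_def invertible_def
    by (rule someI_ex)
  then show "G x ** ginv G x = mat 1" "ginv G x ** G x = mat 1"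
    by auto
qed

lemma G_ginv:
  "x \<in> U \<Longrightarrow> (\<Sum>j\<in>UNIV. G x $ i $ j * ginv G x $ j $ k) = (if i = k then 1 else 0)"
  using ginv_mult(1) unfolding matrix_matrix_mult_def mat_def by (simp add: vec_eq_iff)

lemma ginv_G:
  "x \<in> U \<Longrightarrow> (\<Sum>j\<in>UNIV. ginv G x $ i $ j * G x $ j $ k) = (if i = k then 1 else 0)"
  using ginv_mult(2) unfolding matrix_matrix_mult_def mat_def by (simp add: vec_eq_iff)

lemma ginv_sym:
  assumes "x \<in> U" shows "ginv G x $ i $ j = ginv G x $ j $ i"
proof -
  have "transpose (ginv G x) ** G x = mat 1"
    using ginv_mult(1)[OF assms] transpose_G[OF assms] by (metis matrix_transpose_mul transpose_mat)
  then have "transpose (ginv G x) = ginv G x"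
    using ginv_mult(1)[OF assms] by (metis matrix_mul_assoc matrix_mul_lid matrix_mul_rid)
  then show ?thesis
    by (metis transpose_def vec_lambda_beta)
qed

lemma G_differentiable: "x \<in> U \<Longrightarrow> (\<lambda>y. G y $ i $ j) differentiable (at x)"
  using smooth_on_differentiable[OF smooth_G] .

text \<open>Column \<open>j\<close> of the inverse solves \<open>G v = e_j\<close>. Cramer's rule
  gives its entry \<open>i\<close> as a quotient of determinants, the numerator having column
  \<open>i\<close> of the metric replaced by the constant \<open>e_j\<close>.\<close>

lemma ginv_differentiable:
  assumes "x \<in> U" shows "(\<lambda>y. ginv G y $ i $ j) differentiable (at x)"
proof (rule differentiable_cong[OF open_U assms])
  let ?N = "\<lambda>y. (\<chi> a b. if b = i then axis j 1 $ a else G y $ a $ b) :: real ^ 'n ^ 'n"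
  show "ginv G y $ i $ j = det (?N y) / det (G y)" if "y \<in> U" for y
  proof -
    have "G y *v (ginv G y *v axis j 1) = axis j 1"
      using ginv_mult[OF that] by (simp add: matrix_vector_mul_assoc)
    then have "ginv G y *v axis j 1
        = (\<chi> k. det (\<chi> a b. if b = k then axis j 1 $ a else G y $ a $ b) / det (G y))"
      using invertible_G[OF that] by (simp add: cramer invertible_det_nz)
    moreover have "(ginv G y *v axis j 1) $ i = ginv G y $ i $ j"
      by (simp add: matrix_vector_mult_basis column_def)
    ultimately show ?thesis
      by simp
  qed
  have "(\<lambda>y. ?N y $ a $ b) differentiable (at x)" for a b
    by (cases "b = i") (simp_all add: G_differentiable assms)
  then show "(\<lambda>y. det (?N y) / det (G y)) differentiable (at x)"
    using invertible_G[OF assms] assms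
    by (intro differentiable_divide differentiable_det G_differentiable) (auto simp: invertible_det_nz)
qed

section \<open>The Levi-Civita connection, gradients and Hessians\<close>

lemma pd_G_sym: "x \<in> U \<Longrightarrow> pd k (\<lambda>y. G y $ i $ j) x = pd k (\<lambda>y. G y $ j $ i) x"
  by (rule pd_cong[OF open_U]) (auto intro: G_sym)

lemma christoffel_sym: "x \<in> U \<Longrightarrow> christoffel G k i j x = christoffel G k j i x"
  unfolding christoffel_def by (simp add: pd_G_sym[of x _ i j] add.commute)

lemma christoffel_differentiable: "x \<in> U \<Longrightarrow> christoffel G k i j differentiable (at x)"
  unfolding christoffel_def[abs_def]
  by (intro differentiable_mult differentiable_sum differentiable_diff differentiable_add
      differentiable_const ballI ginv_differentiable smooth_on_differentiable[OF smooth_on_pd[OF smooth_G]]) auto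

text \<open>Metric compatibility of the connection in coordinates. Lowering the upper index yields
  Christoffel symbols of the first kind; in the sum of the two, everything but the derivative in
  direction \<open>k\<close> cancels.\<close>

lemma pd_metric:
  assumes "x \<in> U"
  shows "pd k (\<lambda>y. G y $ i $ j) x = (\<Sum>l\<in>UNIV. G x $ i $ l * christoffel G l k j x)
      + (\<Sum>l\<in>UNIV. G x $ j $ l * christoffel G l k i x)"
proof -
  have lower: "(\<Sum>l\<in>UNIV. G x $ a $ l * christoffel G l k b x) =
      1/2 * (pd k (\<lambda>y. G y $ b $ a) x + pd b (\<lambda>y. G y $ k $ a) x - pd a (\<lambda>y. G y $ k $ b) x)" for a b
  proof -
    have "(\<Sum>l\<in>UNIV. G x $ a $ l * christoffel G l k b x) =
       1/2 * (\<Sum>l\<in>UNIV. G x $ a $ l * (\<Sum>m\<in>UNIV. ginv G x $ l $ m *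
        (pd k (\<lambda>y. G y $ b $ m) x + pd b (\<lambda>y. G y $ k $ m) x - pd m (\<lambda>y. G y $ k $ b) x)))"
      unfolding christoffel_def by (simp add: sum_distrib_left mult.left_commute)
    also have "\<dots> = 1/2 * (pd k (\<lambda>y. G y $ b $ a) x + pd b (\<lambda>y. G y $ k $ a) x - pd a (\<lambda>y. G y $ k $ b) x)"
      by (subst sum_kronecker_contract[where P = "\<lambda>i j. G x $ i $ j"]) (simp_all add: G_ginv assms)
    finally show ?thesis .
  qed
  show ?thesis
    unfolding lower using pd_G_sym[OF assms, of k i j] by (simp add: field_simps)
qed

lemma lower_grad: "x \<in> U \<Longrightarrow> pd j u x = (\<Sum>i\<in>UNIV. G x $ j $ i * grad G u x $ i)"
  unfolding grad_def using sum_kronecker_contract[of "\<lambda>i j. G x $ i $ j" "\<lambda>i j. ginv G x $ i $ j", OF G_ginv]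
  by simp

lemma vec_norm_sq_grad:
  "x \<in> U \<Longrightarrow> vec_norm_sq G x (grad G u x) = (\<Sum>i\<in>UNIV. grad G u x $ i * pd i u x)"
  by (simp add: vec_norm_sq_def inner_vec_def matrix_vector_mult_def lower_grad)

lemma grad_differentiable:
  assumes "x \<in> U" "\<And>j. pd j u differentiable (at x)"
  shows "(\<lambda>y. grad G u y $ i) differentiable (at x)"
  unfolding grad_def using assms by (simp add: ginv_differentiable)

text \<open>Differentiating \<open>\<partial>\<^sub>j u = g\<^sub>j\<^sub>i u\<^sup>i\<close> rather than \<open>u\<^sup>i = g\<^sup>i\<^sup>j \<partial>\<^sub>j u\<close> avoids the derivatives of the inverse metric.\<close>

lemma hessian_eq_lower_cov_grad:
  assumes x: "x \<in> U" and diff: "\<And>j. pd j u differentiable (at x)"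
  shows "hessian G u k j x = (\<Sum>l\<in>UNIV. G x $ j $ l * cov G (grad G u) l k x)"
proof -
  let ?\<Gamma> = "\<lambda>l k i. christoffel G l k i x" and ?w = "\<lambda>i. grad G u x $ i"
  have "pd k (pd j u) x = pd k (\<lambda>y. \<Sum>i\<in>UNIV. G y $ j $ i * grad G u y $ i) x"
    by (rule pd_cong[OF open_U x]) (rule lower_grad)
  also have "\<dots> = (\<Sum>i\<in>UNIV. pd k (\<lambda>y. G y $ j $ i) x * ?w i)
      + (\<Sum>i\<in>UNIV. G x $ j $ i * pd k (\<lambda>y. grad G u y $ i) x)"
    using x diff
    by (simp add: pd_sum pd_mult G_differentiable grad_differentiable sum.distrib)
  also have "(\<Sum>i\<in>UNIV. pd k (\<lambda>y. G y $ j $ i) x * ?w i)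
      = (\<Sum>i\<in>UNIV. \<Sum>l\<in>UNIV. G x $ j $ l * ?\<Gamma> l k i * ?w i)
        + (\<Sum>i\<in>UNIV. \<Sum>l\<in>UNIV. G x $ i $ l * ?\<Gamma> l k j * ?w i)"
    by (simp add: pd_metric[OF x] distrib_right sum.distrib sum_distrib_right)
  also have "(\<Sum>i\<in>UNIV. \<Sum>l\<in>UNIV. G x $ j $ l * ?\<Gamma> l k i * ?w i)
      = (\<Sum>l\<in>UNIV. G x $ j $ l * (\<Sum>i\<in>UNIV. ?\<Gamma> l k i * ?w i))"
    by (subst sum.swap) (simp add: sum_distrib_left mult.assoc)
  \<comment> \<open>Lowering \<open>grad G u\<close> again turns this half of metric compatibility
    into the connection term of the Hessian.\<close>
  also have "(\<Sum>i\<in>UNIV. \<Sum>l\<in>UNIV. G x $ i $ l * ?\<Gamma> l k j * ?w i)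
      = (\<Sum>l\<in>UNIV. ?\<Gamma> l k j * pd l u x)"
    unfolding lower_grad[OF x]
    by (subst sum.swap) (simp add: sum_distrib_left G_sym[OF x] mult_ac)
  finally show ?thesis
    by (simp add: hessian_def cov_def distrib_left sum.distrib)
qed

lemma cov_grad_eq_raise_hessian:
  assumes "x \<in> U" "\<And>j. pd j u differentiable (at x)"
  shows "cov G (grad G u) i k x = (\<Sum>j\<in>UNIV. ginv G x $ i $ j * hessian G u k j x)"
  unfolding hessian_eq_lower_cov_grad[OF assms]
  using sum_kronecker_contract[of "\<lambda>i j. ginv G x $ i $ j" "\<lambda>i j. G x $ i $ j", OF ginv_G[OF assms(1)]]
  by simp

text \<open>The contracted Ricci identity \<open>\<nabla>\<^sub>i \<nabla>\<^sub>j Z\<^sup>i = \<nabla>\<^sub>j \<nabla>\<^sub>i Z\<^sup>i + R\<^sub>j\<^sub>l Z\<^sup>l\<close>.\<close>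

lemma contracted_ricci_identity:
  assumes x: "x \<in> U" and Z: "\<And>y i. y \<in> U \<Longrightarrow> (\<lambda>z. Z z $ i) differentiable (at y)"
    and dZ: "\<And>i j. pd j (\<lambda>z. Z z $ i) differentiable (at x)"
  shows "(\<Sum>i\<in>UNIV. pd i (cov G Z i j) x + (\<Sum>k\<in>UNIV. christoffel G i i k x * cov G Z k j x)
        - (\<Sum>k\<in>UNIV. christoffel G k i j x * cov G Z i k x))
    = pd j (divergence G Z) x + (\<Sum>l\<in>UNIV. ricci G j l x * Z x $ l)"
proof -
  let ?\<Gamma> = "\<lambda>k i j. christoffel G k i j x" and ?Z = "\<lambda>i. Z x $ i"
  let ?d = "\<lambda>i l. pd i (\<lambda>z. Z z $ l) x"
  have pd_cov: "pd i (cov G Z a b) x = pd i (pd b (\<lambda>z. Z z $ a)) x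
      + (\<Sum>l\<in>UNIV. pd i (christoffel G a b l) x * ?Z l) + (\<Sum>l\<in>UNIV. ?\<Gamma> a b l * ?d i l)" for i a b
    unfolding cov_def[abs_def] using x Z dZ christoffel_differentiable
    by (simp add: pd_add pd_sum pd_mult sum.distrib)
  have cov_diff: "cov G Z a b differentiable (at x)" for a b
    unfolding cov_def[abs_def] using x Z dZ christoffel_differentiable by simp
  have comm: "pd i (pd j (\<lambda>z. Z z $ i)) x = pd j (pd i (\<lambda>z. Z z $ i)) x" for i
    by (rule pd_commute[OF open_U x]) (use Z dZ in auto)
  have 1: "(\<Sum>k\<in>UNIV. ?\<Gamma> i i k * cov G Z k j x) = (\<Sum>k\<in>UNIV. ?\<Gamma> i i k * ?d j k)
     + (\<Sum>l\<in>UNIV. \<Sum>k\<in>UNIV. ?\<Gamma> i i k * ?\<Gamma> k j l * ?Z l)" for i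
    unfolding cov_def
    by (simp add: distrib_left sum.distrib sum_distrib_left mult.assoc)
      (rule sum.swap)
  have 2: "(\<Sum>i\<in>UNIV. \<Sum>k\<in>UNIV. ?\<Gamma> k i j * cov G Z i k x) = (\<Sum>i\<in>UNIV. \<Sum>l\<in>UNIV. ?\<Gamma> i j l * ?d i l)
     + (\<Sum>i\<in>UNIV. \<Sum>l\<in>UNIV. \<Sum>k\<in>UNIV. ?\<Gamma> i j k * ?\<Gamma> k i l * ?Z l)"
  proof -
    \<comment> \<open>Renaming \<open>i\<close> and \<open>k\<close> and using that the connection
      is torsion-free brings the product into the index pattern of the Ricci tensor.\<close>
    have "(\<Sum>i\<in>UNIV. \<Sum>k\<in>UNIV. ?\<Gamma> k i j * cov G Z i k x)
        = (\<Sum>i\<in>UNIV. \<Sum>k\<in>UNIV. ?\<Gamma> i j k * cov G Z k i x)"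
      by (subst sum.swap) (simp add: christoffel_sym[OF x, of _ _ j])
    also have "\<dots> = (\<Sum>i\<in>UNIV. (\<Sum>l\<in>UNIV. ?\<Gamma> i j l * ?d i l)
       + (\<Sum>l\<in>UNIV. \<Sum>k\<in>UNIV. ?\<Gamma> i j k * ?\<Gamma> k i l * ?Z l))"
      unfolding cov_def
      by (simp add: distrib_left sum.distrib sum_distrib_left mult.assoc)
        (intro sum.cong refl sum.swap)
    finally show ?thesis
      by (simp add: sum.distrib)
  qed
  have 3: "(\<Sum>l\<in>UNIV. ricci G j l x * ?Z l) =
     (\<Sum>i\<in>UNIV. \<Sum>l\<in>UNIV. pd i (christoffel G i j l) x * ?Z l)
     - (\<Sum>i\<in>UNIV. \<Sum>l\<in>UNIV. pd j (christoffel G i i l) x * ?Z l)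
     + (\<Sum>i\<in>UNIV. \<Sum>l\<in>UNIV. \<Sum>k\<in>UNIV. ?\<Gamma> i i k * ?\<Gamma> k j l * ?Z l)
     - (\<Sum>i\<in>UNIV. \<Sum>l\<in>UNIV. \<Sum>k\<in>UNIV. ?\<Gamma> i j k * ?\<Gamma> k i l * ?Z l)"
    unfolding ricci_def riemann_def sum_distrib_right
    by (subst sum.swap) (simp add: sum_distrib_left sum_distrib_right algebra_simps sum.distrib sum_subtractf)
  have 4: "pd j (divergence G Z) x = (\<Sum>i\<in>UNIV. pd j (cov G Z i i) x)"
    unfolding divergence_eq_cov_trace[abs_def] by (rule pd_sum) (rule cov_diff)
  \<comment> \<open>The terms \<open>?\<Gamma> i j l * ?d i l\<close> from \<open>pd_cov\<close> and
    \<open>2\<close> cancel, those of the form \<open>?\<Gamma> i i k * ?d j k\<close> occur on both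
    sides, the second partials commute, and what is left is the expansion \<open>3\<close> of the
    Ricci term.\<close>
  show ?thesis
    unfolding 3 4 pd_cov 1 sum.distrib sum_subtractf 2 comm by simp
qed

end

subsection \<open>Norms of alternated products\<close>

lemma sum3_separate:
  fixes C :: "'n::finite \<Rightarrow> 'n \<Rightarrow> real"
  shows "(\<Sum>i\<in>UNIV. \<Sum>j\<in>UNIV. \<Sum>k\<in>UNIV. (C i k * y j) * (C' i k * y' j))
    = (\<Sum>i\<in>UNIV. \<Sum>k\<in>UNIV. C i k * C' i k) * (\<Sum>j\<in>UNIV. y j * y' j)"
proof -
  have "(\<Sum>j\<in>UNIV. \<Sum>k\<in>UNIV. (C i k * y j) * (C' i k * y' j))
      = (\<Sum>k\<in>UNIV. C i k * C' i k) * (\<Sum>j\<in>UNIV. y j * y' j)" for i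
    unfolding sum_product by (subst sum.swap) (simp add: mult_ac)
  then show ?thesis
    by (simp add: sum_distrib_right)
qed

lemma sum3_cross:
  fixes C :: "'n::finite \<Rightarrow> 'n \<Rightarrow> real"
  shows "(\<Sum>i\<in>UNIV. \<Sum>j\<in>UNIV. \<Sum>k\<in>UNIV. (C i k * y j) * (C' j k * y' i))
    = (\<Sum>k\<in>UNIV. (\<Sum>i\<in>UNIV. C i k * y' i) * (\<Sum>j\<in>UNIV. C' j k * y j))"
proof -
  have "(\<Sum>i\<in>UNIV. \<Sum>j\<in>UNIV. \<Sum>k\<in>UNIV. (C i k * y j) * (C' j k * y' i))
      = (\<Sum>i\<in>UNIV. \<Sum>k\<in>UNIV. \<Sum>j\<in>UNIV. (C i k * y j) * (C' j k * y' i))"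
    by (intro sum.cong refl sum.swap)
  also have "\<dots> = (\<Sum>k\<in>UNIV. \<Sum>i\<in>UNIV. \<Sum>j\<in>UNIV. (C i k * y j) * (C' j k * y' i))"
    by (rule sum.swap)
  finally show ?thesis
    unfolding sum_product by (simp add: mult_ac)
qed

text \<open>Applied with \<open>S'\<close> equal to \<open>S\<close> with all indices raised: the
  squared norm of an alternation is twice that of \<open>S\<close> minus twice the pairing of
  \<open>S\<close> with its transpose. \<open>sum3_separate\<close> evaluates the former,
  \<open>sum3_cross\<close> the latter.\<close>

lemma sum3_antisym:
  fixes S :: "'n::finite \<Rightarrow> 'n \<Rightarrow> 'n \<Rightarrow> real"
  shows "(\<Sum>i\<in>UNIV. \<Sum>j\<in>UNIV. \<Sum>k\<in>UNIV. (S i j k - S j i k) * (S' i j k - S' j i k))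
    = 2 * (\<Sum>i\<in>UNIV. \<Sum>j\<in>UNIV. \<Sum>k\<in>UNIV. S i j k * S' i j k)
      - 2 * (\<Sum>i\<in>UNIV. \<Sum>j\<in>UNIV. \<Sum>k\<in>UNIV. S i j k * S' j i k)"
proof -
  have 1: "(\<Sum>i\<in>UNIV. \<Sum>j\<in>UNIV. \<Sum>k\<in>UNIV. S j i k * S' j i k)
      = (\<Sum>i\<in>UNIV. \<Sum>j\<in>UNIV. \<Sum>k\<in>UNIV. S i j k * S' i j k)"
    by (rule sum.swap)
  have 2: "(\<Sum>i\<in>UNIV. \<Sum>j\<in>UNIV. \<Sum>k\<in>UNIV. S j i k * S' i j k)
      = (\<Sum>i\<in>UNIV. \<Sum>j\<in>UNIV. \<Sum>k\<in>UNIV. S i j k * S' j i k)"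
    by (rule sum.swap)
  show ?thesis
    by (simp add: left_diff_distrib right_diff_distrib sum.distrib sum_subtractf 1 2)
qed

lemma raise_product:
  fixes P :: "'n::finite \<Rightarrow> 'n \<Rightarrow> real"
  shows "(\<Sum>a\<in>UNIV. \<Sum>b\<in>UNIV. \<Sum>c\<in>UNIV. P i a * P j b * P k c * (C a c * y b))
    = (\<Sum>a\<in>UNIV. \<Sum>c\<in>UNIV. P i a * P k c * C a c) * (\<Sum>b\<in>UNIV. P j b * y b)"
proof -
  have "(\<Sum>b\<in>UNIV. \<Sum>c\<in>UNIV. P i a * P j b * P k c * (C a c * y b))
      = (\<Sum>c\<in>UNIV. P i a * P k c * C a c) * (\<Sum>b\<in>UNIV. P j b * y b)" for a
    unfolding sum_product by (subst sum.swap) (simp add: mult_ac)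
  then show ?thesis
    by (simp add: sum_distrib_right)
qed

text \<open>Replaces the sixfold sum by a pairing of \<open>T\<close> with its raised form, which
  can be computed once beforehand.\<close>

lemma tensor3_norm_sq_raise:
  "tensor3_norm_sq G x T = (\<Sum>i\<in>UNIV. \<Sum>j\<in>UNIV. \<Sum>k\<in>UNIV. T i j k *
     (\<Sum>a\<in>UNIV. \<Sum>b\<in>UNIV. \<Sum>c\<in>UNIV. ginv G x $ i $ a * ginv G x $ j $ b * ginv G x $ k $ c * T a b c))"
  unfolding tensor3_norm_sq_def by (simp add: sum_distrib_left mult_ac)

lemma tensor3_norm_sq_scale: "tensor3_norm_sq G x (\<lambda>i j k. s * T i j k) = s\<^sup>2 * tensor3_norm_sq G x T"
  unfolding tensor3_norm_sq_def by (simp add: sum_distrib_left power2_eq_square mult_ac)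

context riemannian_chart
begin

text \<open>With S_ijk = B_ik v_j - \<kappa> g_ik w_j, the norm of S gives |B|^2 |v|^2 - 2 \<kappa>
  tr(B) <v,w> + n \<kappa>^2 |w|^2, and the pairing of S with its transpose gives |b|^2 - 2 \<kappa>
  <b,w> + \<kappa>^2 |w|^2. Here \<open>b\<close> is B applied to the raised \<open>v\<close>, and
  \<open>M\<close> is B with its first index raised.\<close>

lemma tensor3_norm_sq_alternated:
  fixes B :: "'n \<Rightarrow> 'n \<Rightarrow> real" and v w :: "'n \<Rightarrow> real"
  assumes x: "x \<in> U" and B: "\<And>i j. B i j = B j i"
  defines "vv \<equiv> (\<lambda>i. \<Sum>j\<in>UNIV. ginv G x $ i $ j * v j)"
    and "ww \<equiv> (\<lambda>i. \<Sum>j\<in>UNIV. ginv G x $ i $ j * w j)"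
    and "M \<equiv> (\<lambda>i j. \<Sum>a\<in>UNIV. ginv G x $ i $ a * B a j)"
  defines "b \<equiv> (\<lambda>k. \<Sum>i\<in>UNIV. B k i * vv i)"
  shows "tensor3_norm_sq G x (\<lambda>i j k. (B i k * v j - \<kappa> * (G x $ i $ k * w j))
            - (B j k * v i - \<kappa> * (G x $ j $ k * w i)))
    = 2 * (\<Sum>i\<in>UNIV. \<Sum>j\<in>UNIV. M i j * M j i) * (\<Sum>j\<in>UNIV. v j * vv j)
      - 2 * (\<Sum>k\<in>UNIV. b k * (\<Sum>j\<in>UNIV. ginv G x $ k $ j * b j))
      + 4 * \<kappa> * ((\<Sum>k\<in>UNIV. b k * ww k) - (\<Sum>i\<in>UNIV. M i i) * (\<Sum>j\<in>UNIV. v j * ww j))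
      + 2 * \<kappa>\<^sup>2 * (real CARD('n) - 1) * (\<Sum>j\<in>UNIV. w j * ww j)"
proof -
  let ?P = "\<lambda>i j. ginv G x $ i $ j" and ?Q = "\<lambda>i j. G x $ i $ j"
  \<comment> \<open>\<open>BB\<close> and \<open>S'\<close> are \<open>B\<close> and
    \<open>S\<close> with all indices raised; by \<open>QQ\<close> the metric raises to its
    inverse.\<close>
  define BB where "BB i k = (\<Sum>a\<in>UNIV. \<Sum>c\<in>UNIV. ?P i a * ?P k c * B a c)" for i k
  define S where "S i j k = B i k * v j - \<kappa> * (?Q i k * w j)" for i j k
  define S' where "S' i j k = BB i k * vv j - \<kappa> * (?P i k * ww j)" for i j k
  have PQ: "(\<Sum>c\<in>UNIV. ?P k c * ?Q a c) = (if a = k then 1 else 0)" for a k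
    using G_ginv[OF x, of a k] by (simp add: ginv_sym[OF x, of _ k] mult.commute)
  have QQ: "(\<Sum>a\<in>UNIV. \<Sum>c\<in>UNIV. ?P i a * ?P k c * ?Q a c) = ?P i k" for i k
  proof -
    have "(\<Sum>c\<in>UNIV. ?P i a * ?P k c * ?Q a c) = (if a = k then ?P i a else 0)" for a
      by (simp add: mult.assoc sum_distrib_left[symmetric] PQ)
    then show ?thesis
      by simp
  qed
  have raise: "(\<Sum>a\<in>UNIV. \<Sum>b\<in>UNIV. \<Sum>c\<in>UNIV. ?P i a * ?P j b * ?P k c * S a b c) = S' i j k" for i j k
  proof -
    have "(\<Sum>a\<in>UNIV. \<Sum>b\<in>UNIV. \<Sum>c\<in>UNIV. ?P i a * ?P j b * ?P k c * S a b c)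
      = (\<Sum>a\<in>UNIV. \<Sum>b\<in>UNIV. \<Sum>c\<in>UNIV. ?P i a * ?P j b * ?P k c * (B a c * v b))
       - \<kappa> * (\<Sum>a\<in>UNIV. \<Sum>b\<in>UNIV. \<Sum>c\<in>UNIV. ?P i a * ?P j b * ?P k c * (?Q a c * w b))"
      unfolding S_def by (simp add: right_diff_distrib sum_subtractf sum_distrib_left mult_ac)
    then show ?thesis
      unfolding raise_product[of ?P i j k B v] raise_product[of ?P i j k ?Q w] S'_def QQ vv_def ww_def BB_def by simp
  qed
  have raise': "(\<Sum>a\<in>UNIV. \<Sum>b\<in>UNIV. \<Sum>c\<in>UNIV. ?P i a * ?P j b * ?P k c * (S a b c - S b a c))
     = S' i j k - S' j i k" for i j k
  proof -
    have "(\<Sum>a\<in>UNIV. \<Sum>b\<in>UNIV. \<Sum>c\<in>UNIV. ?P i a * ?P j b * ?P k c * S b a c)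
      = (\<Sum>a\<in>UNIV. \<Sum>b\<in>UNIV. \<Sum>c\<in>UNIV. ?P j a * ?P i b * ?P k c * S a b c)"
      by (subst sum.swap) (simp only: mult.commute mult.left_commute)
    then show ?thesis
      by (simp add: right_diff_distrib sum_subtractf raise)
  qed
  have lower: "(\<Sum>i\<in>UNIV. ?Q i k * (\<Sum>j\<in>UNIV. ?P i j * y j)) = y k" for y k
    using sum_kronecker_contract[of ?Q ?P k y, OF G_ginv[OF x]] by (simp only: G_sym[OF x, of _ k])
  have BB: "BB i k = (\<Sum>c\<in>UNIV. ?P k c * M i c)" for i k
    unfolding BB_def M_def by (subst sum.swap) (simp add: sum_distrib_left mult_ac)
  have tr: "(\<Sum>i\<in>UNIV. \<Sum>k\<in>UNIV. ?Q i k * BB i k) = (\<Sum>i\<in>UNIV. M i i)"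
    unfolding BB using sum_kronecker_contract[of ?Q ?P, OF G_ginv[OF x]] by simp
  have tr': "(\<Sum>i\<in>UNIV. \<Sum>k\<in>UNIV. B i k * ?P i k) = (\<Sum>i\<in>UNIV. M i i)"
    unfolding M_def by (intro sum.cong refl) (simp only: B mult.commute)
  have n: "(\<Sum>i\<in>UNIV. \<Sum>k\<in>UNIV. ?Q i k * ?P i k) = real CARD('n)"
    using PQ by (simp add: mult.commute)
  \<comment> \<open>Of the two inverse metrics in |B|^2, each factor \<open>B\<close> absorbs one,
    which leaves the trace of the square of \<open>M\<close>.\<close>
  have norm_B: "(\<Sum>i\<in>UNIV. \<Sum>k\<in>UNIV. B i k * BB i k) = (\<Sum>i\<in>UNIV. \<Sum>j\<in>UNIV. M i j * M j i)"
  proof -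
    have "(\<Sum>k\<in>UNIV. B i k * BB i k) = (\<Sum>c\<in>UNIV. \<Sum>k\<in>UNIV. B i k * (?P k c * M i c))" for i
      unfolding BB sum_distrib_left by (rule sum.swap)
    also have "\<dots> i = (\<Sum>j\<in>UNIV. M i j * M j i)" for i
    proof (rule sum.cong[OF refl])
      fix c
      have "(\<Sum>k\<in>UNIV. B i k * (?P k c * M i c)) = M i c * (\<Sum>k\<in>UNIV. ?P k c * B i k)"
        by (simp add: sum_distrib_left mult_ac)
      then show "(\<Sum>k\<in>UNIV. B i k * (?P k c * M i c)) = M i c * M c i"
        by (simp add: M_def ginv_sym[OF x, of _ c] B[of i])
    qed
    finally show ?thesis
      by simp
  qed
  have vv: "vv k = (\<Sum>j\<in>UNIV. ?P k j * v j)" and ww: "ww k = (\<Sum>j\<in>UNIV. ?P k j * w j)" for k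
    by (simp_all add: vv_def ww_def)
  have vsym: "(\<Sum>j\<in>UNIV. ?P j k * y j) = (\<Sum>j\<in>UNIV. ?P k j * y j)" for k y
    by (simp add: ginv_sym[OF x, of _ k])
  \<comment> \<open>Self-adjointness of a symmetric matrix; it moves \<open>B\<close> and the
    inverse metric from one argument of a pairing to the other.\<close>
  have pair_sym: "(\<Sum>k\<in>UNIV. y k * (\<Sum>j\<in>UNIV. A k j * z j)) = (\<Sum>k\<in>UNIV. (\<Sum>j\<in>UNIV. A k j * y j) * z k)"
    if "\<And>k j. A k j = A j k" for A :: "'n \<Rightarrow> 'n \<Rightarrow> real" and y z
    unfolding sum_distrib_left sum_distrib_right
    by (subst sum.swap) (simp add: that mult_ac)
  have BB_mult: "(\<Sum>j\<in>UNIV. BB j k * y j) = (\<Sum>c\<in>UNIV. ?P k c * (\<Sum>a\<in>UNIV. B c a * (\<Sum>j\<in>UNIV. ?P a j * y j)))" for k y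
  proof -
    have M: "(\<Sum>j\<in>UNIV. M j c * y j) = (\<Sum>a\<in>UNIV. B c a * (\<Sum>j\<in>UNIV. ?P a j * y j))" for c
      unfolding M_def sum_distrib_left sum_distrib_right
      by (subst sum.swap) (intro sum.cong refl, simp only: B[of c] ginv_sym[OF x, of _ a for a] mult_ac)
    have "(\<Sum>j\<in>UNIV. BB j k * y j) = (\<Sum>j\<in>UNIV. \<Sum>c\<in>UNIV. ?P k c * (M j c * y j))"
      unfolding BB by (simp add: sum_distrib_right mult.assoc)
    also have "\<dots> = (\<Sum>c\<in>UNIV. ?P k c * (\<Sum>j\<in>UNIV. M j c * y j))"
      unfolding sum_distrib_left by (rule sum.swap)
    finally show ?thesis
      unfolding M .
  qed
  have vw: "(\<Sum>j\<in>UNIV. w j * vv j) = (\<Sum>j\<in>UNIV. v j * ww j)"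
    unfolding vv_def ww_def
    using pair_sym[of ?P w v] by (simp add: ginv_sym[OF x] mult.commute)
  have SS: "(\<Sum>i\<in>UNIV. \<Sum>j\<in>UNIV. \<Sum>k\<in>UNIV. S i j k * S' i j k) =
      (\<Sum>i\<in>UNIV. \<Sum>j\<in>UNIV. M i j * M j i) * (\<Sum>j\<in>UNIV. v j * vv j)
      - 2 * \<kappa> * ((\<Sum>i\<in>UNIV. M i i) * (\<Sum>j\<in>UNIV. v j * ww j))
      + \<kappa>\<^sup>2 * (real CARD('n) * (\<Sum>j\<in>UNIV. w j * ww j))"
  proof -
    have "S i j k * S' i j k = (B i k * v j) * (BB i k * vv j) - \<kappa> * ((B i k * v j) * (?P i k * ww j))
       - \<kappa> * ((?Q i k * w j) * (BB i k * vv j)) + \<kappa>\<^sup>2 * ((?Q i k * w j) * (?P i k * ww j))" for i j k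
      by (simp add: S_def S'_def algebra_simps power2_eq_square)
    then show ?thesis
      by (simp only: sum.distrib sum_subtractf sum_distrib_left[symmetric] sum3_separate tr tr' n norm_B vw)
  qed
  have SS': "(\<Sum>i\<in>UNIV. \<Sum>j\<in>UNIV. \<Sum>k\<in>UNIV. S i j k * S' j i k) =
      (\<Sum>k\<in>UNIV. b k * (\<Sum>j\<in>UNIV. ?P k j * b j))
      - 2 * \<kappa> * (\<Sum>k\<in>UNIV. b k * ww k)
      + \<kappa>\<^sup>2 * (\<Sum>j\<in>UNIV. w j * ww j)"
  proof -
    have "S i j k * S' j i k = (B i k * v j) * (BB j k * vv i) - \<kappa> * ((B i k * v j) * (?P j k * ww i))
       - \<kappa> * ((?Q i k * w j) * (BB j k * vv i)) + \<kappa>\<^sup>2 * ((?Q i k * w j) * (?P j k * ww i))" for i j k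
      by (simp add: S_def S'_def algebra_simps power2_eq_square)
    moreover have "(\<Sum>i\<in>UNIV. ?Q i k * vv i) = v k" "(\<Sum>i\<in>UNIV. ?Q i k * ww i) = w k"
       "(\<Sum>j\<in>UNIV. ?P j k * v j) = vv k" "(\<Sum>j\<in>UNIV. ?P j k * w j) = ww k" for k
      unfolding vv_def ww_def by (rule lower vsym)+
    moreover have "(\<Sum>i\<in>UNIV. B i k * vv i) = b k" for k
      by (simp only: b_def B[of k])
    moreover have "(\<Sum>k\<in>UNIV. (\<Sum>i\<in>UNIV. B i k * ww i) * vv k) = (\<Sum>k\<in>UNIV. b k * ww k)"
    proof -
      have "(\<Sum>i\<in>UNIV. B i k * ww i) = (\<Sum>i\<in>UNIV. B k i * ww i)" for k
        by (simp only: B[of k])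
      then show ?thesis
        unfolding b_def using pair_sym[of B vv ww, OF B] by (simp only: mult.commute)
    qed
    moreover have "(\<Sum>j\<in>UNIV. BB j k * v j) = (\<Sum>j\<in>UNIV. ?P k j * b j)" for k
      unfolding BB_mult b_def vv_def ..
    moreover have "(\<Sum>k\<in>UNIV. v k * (\<Sum>j\<in>UNIV. BB j k * w j)) = (\<Sum>k\<in>UNIV. b k * ww k)"
      unfolding BB_mult ww[symmetric] pair_sym[of ?P v, OF ginv_sym[OF x]] vv[symmetric] b_def
      by (rule pair_sym[OF B])
    ultimately show ?thesis
      by (simp only: sum.distrib sum_subtractf sum_distrib_left[symmetric] sum3_cross)
  qed
  have "tensor3_norm_sq G x (\<lambda>i j k. S i j k - S j i k) =
      (\<Sum>i\<in>UNIV. \<Sum>j\<in>UNIV. \<Sum>k\<in>UNIV. (S i j k - S j i k) * (S' i j k - S' j i k))"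
    unfolding tensor3_norm_sq_raise raise' ..
  then show ?thesis
    unfolding sum3_antisym SS SS' unfolding S_def by (simp add: algebra_simps)
qed

end

subsection \<open>Steady solitons\<close>

lemma divergence_diff:
  assumes "\<And>i. (\<lambda>y. Y y $ i) differentiable (at x)" "\<And>i. (\<lambda>y. Z y $ i) differentiable (at x)"
  shows "divergence G (\<lambda>y. Y y - Z y) x = divergence G Y x - divergence G Z x"
  using assms by (simp add: divergence_def pd_diff sum.distrib sum_subtractf right_diff_distrib)

lemma divergence_scaleR:
  assumes "\<phi> differentiable (at x)" "\<And>i. (\<lambda>y. Z y $ i) differentiable (at x)"
  shows "divergence G (\<lambda>y. \<phi> y *\<^sub>R Z y) x = \<phi> x * divergence G Z x + (\<Sum>i\<in>UNIV. pd i \<phi> x * Z x $ i)"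
  using assms by (simp add: divergence_def pd_mult sum.distrib sum_distrib_left algebra_simps)

locale steady_soliton_chart = riemannian_chart U G
  for U :: "(real ^ 'n::finite) set" and G +
  fixes u :: "real ^ 'n \<Rightarrow> real"
  assumes smooth_u: "smooth_on U u"
    and soliton: "\<And>x i j. x \<in> U \<Longrightarrow> ricci G i j x = hessian G u i j x"
    and normalization: "\<And>x. x \<in> U \<Longrightarrow> scalar_curvature G x + vec_norm_sq G x (grad G u x) = 1"
begin

abbreviation "R \<equiv> scalar_curvature G"
abbreviation "H \<equiv> cov G (grad G u)"

lemma differentiable_u: "x \<in> U \<Longrightarrow> u differentiable (at x)"
  and differentiable_pd_u: "x \<in> U \<Longrightarrow> pd j u differentiable (at x)"
  and differentiable_pd_pd_u: "x \<in> U \<Longrightarrow> pd i (pd j u) differentiable (at x)"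
  by (auto intro: smooth_on_differentiable smooth_on_pd smooth_u)

lemma hessian_sym: "x \<in> U \<Longrightarrow> hessian G u i j x = hessian G u j i x"
  unfolding hessian_def
  using pd_commute[OF open_U, of x u i j] differentiable_u differentiable_pd_u
  by (simp add: christoffel_sym[of x _ i j])

lemma H_eq: "x \<in> U \<Longrightarrow> H i k x = (\<Sum>j\<in>UNIV. ginv G x $ i $ j * ricci G j k x)"
  by (simp add: cov_grad_eq_raise_hessian differentiable_pd_u soliton hessian_sym[of x k])

lemma lower_H: "x \<in> U \<Longrightarrow> ricci G j k x = (\<Sum>l\<in>UNIV. G x $ j $ l * H l k x)"
  using hessian_eq_lower_cov_grad[of x u k j] by (simp add: differentiable_pd_u soliton hessian_sym[of x k])

lemma ricci_sym: "x \<in> U \<Longrightarrow> ricci G i j x = ricci G j i x"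
  by (simp add: soliton hessian_sym[of x i])

lemma differentiable_grad_u: "x \<in> U \<Longrightarrow> (\<lambda>y. grad G u y $ i) differentiable (at x)"
  by (intro grad_differentiable differentiable_pd_u)

text \<open>By its definition \<open>H\<close> contains derivatives of \<open>grad G u\<close>,
  hence of the inverse metric. The raised Hessian expresses it by the undifferentiated inverse
  metric, Christoffel symbols and partials of the smooth \<open>u\<close>.\<close>

lemma differentiable_H: "x \<in> U \<Longrightarrow> H i k differentiable (at x)"
proof (rule differentiable_cong[OF open_U])
  fix x assume x: "x \<in> U"
  show "(\<lambda>y. \<Sum>j\<in>UNIV. ginv G y $ i $ j * hessian G u k j y) differentiable (at x)"
    unfolding hessian_def
    using x by (simp add: ginv_differentiable christoffel_differentiable differentiable_pd_u differentiable_pd_pd_u)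
qed (simp_all add: cov_grad_eq_raise_hessian differentiable_pd_u)

lemma pd_grad_u: "pd k (\<lambda>y. grad G u y $ i) x = H i k x - (\<Sum>l\<in>UNIV. christoffel G i k l x * grad G u x $ l)"
  by (simp add: cov_def)

text \<open>Solving the definition of \<open>H\<close> for the partial derivative transfers the
  differentiability of \<open>H\<close>, so the inverse metric is not differentiated twice.\<close>

lemma differentiable_pd_grad_u: "x \<in> U \<Longrightarrow> pd k (\<lambda>y. grad G u y $ i) differentiable (at x)"
  unfolding pd_grad_u[abs_def]
  by (simp add: differentiable_H christoffel_differentiable differentiable_grad_u)

lemma divergence_grad_u: "x \<in> U \<Longrightarrow> divergence G (grad G u) x = R x"
  by (simp add: divergence_eq_cov_trace H_eq scalar_curvature_def ricci_sym)

lemma R_eq: "x \<in> U \<Longrightarrow> R x = 1 - (\<Sum>i\<in>UNIV. grad G u x $ i * pd i u x)"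
  using normalization[of x] by (simp add: vec_norm_sq_grad)

lemma pd_R: 
  assumes x: "x \<in> U"
  shows "pd k R x = - 2 * (\<Sum>j\<in>UNIV. ricci G k j x * grad G u x $ j)"
proof -
  let ?w = "\<lambda>i. grad G u x $ i" and ?\<Gamma> = "\<lambda>l k i. christoffel G l k i x"
  have "pd k R x = pd k (\<lambda>y. 1 - (\<Sum>i\<in>UNIV. grad G u y $ i * pd i u y)) x"
    by (rule pd_cong[OF open_U x]) (rule R_eq)
  also have "\<dots> = - ((\<Sum>i\<in>UNIV. pd k (\<lambda>y. grad G u y $ i) x * pd i u x)
      + (\<Sum>i\<in>UNIV. ?w i * pd k (pd i u) x))"
    using x by (simp add: pd_diff pd_sum pd_mult differentiable_grad_u differentiable_pd_u sum.distrib)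
  \<comment> \<open>The derivative falls once on \<open>u^i\<close> and once on \<open>u_i\<close>.
    Each half equals Ric(grad u) up to a Christoffel term, and the two Christoffel terms are
    opposite.\<close>
  also have "(\<Sum>i\<in>UNIV. pd k (\<lambda>y. grad G u y $ i) x * pd i u x)
      = (\<Sum>i\<in>UNIV. H i k x * pd i u x) - (\<Sum>i\<in>UNIV. \<Sum>l\<in>UNIV. ?\<Gamma> i k l * ?w l * pd i u x)"
    by (simp add: pd_grad_u left_diff_distrib sum_subtractf sum_distrib_right)
  also have "(\<Sum>i\<in>UNIV. H i k x * pd i u x) = (\<Sum>j\<in>UNIV. ricci G k j x * ?w j)"
    unfolding ricci_sym[OF x, of k] unfolding lower_grad[OF x] sum_distrib_left lower_H[OF x] sum_distrib_right
    by (subst sum.swap) (simp add: G_sym[OF x] mult_ac)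
  also have "(\<Sum>i\<in>UNIV. \<Sum>l\<in>UNIV. ?\<Gamma> i k l * ?w l * pd i u x)
      = (\<Sum>l\<in>UNIV. ?w l * (\<Sum>i\<in>UNIV. ?\<Gamma> i k l * pd i u x))"
    by (subst sum.swap) (simp add: sum_distrib_left mult_ac)
  also have "(\<Sum>i\<in>UNIV. ?w i * pd k (pd i u) x) = (\<Sum>j\<in>UNIV. ricci G k j x * ?w j)
      + (\<Sum>l\<in>UNIV. ?w l * (\<Sum>i\<in>UNIV. ?\<Gamma> i k l * pd i u x))"
    by (simp add: soliton[OF x] hessian_def right_diff_distrib sum_subtractf mult.commute)
  finally show ?thesis
    by simp
qed

lemma grad_R:
  assumes x: "x \<in> U"
  shows "grad G R x $ i = - 2 * (\<Sum>j\<in>UNIV. H i j x * grad G u x $ j)"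
proof -
  have "(\<Sum>j\<in>UNIV. H i j x * grad G u x $ j)
      = (\<Sum>k\<in>UNIV. ginv G x $ i $ k * (\<Sum>j\<in>UNIV. ricci G k j x * grad G u x $ j))"
    unfolding H_eq[OF x] sum_distrib_left sum_distrib_right
    by (subst sum.swap) (simp add: mult_ac)
  then show ?thesis
    by (simp add: grad_def pd_R[OF x] sum_distrib_left mult.left_commute sum_negf)
qed

text \<open>Read off from \<open>1 - u^i u_i\<close> rather than from the curvature
  expression.\<close>

lemma differentiable_R:
  assumes x: "x \<in> U" shows "R differentiable (at x)"
  by (rule differentiable_cong[OF open_U x R_eq])
    (auto simp: x differentiable_grad_u differentiable_pd_u)

lemma differentiable_grad_R:
  assumes x: "x \<in> U" shows "(\<lambda>y. grad G R y $ i) differentiable (at x)"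
  by (rule differentiable_cong[OF open_U x grad_R])
    (auto simp: x differentiable_grad_u differentiable_H)

text \<open>The contracted Bianchi identity \<open>\<nabla>\<^sub>i R\<^sup>i\<^sub>j = \<partial>\<^sub>j R / 2\<close> is not needed: on a soliton it follows from
  the Ricci identity for \<open>\<nabla>u\<close> together with \<open>\<partial>\<^sub>j R = -2 R\<^sub>j\<^sub>l u\<^sup>l\<close>.\<close>

lemma divergence_H:
  assumes x: "x \<in> U"
  shows "(\<Sum>i\<in>UNIV. pd i (H i j) x + (\<Sum>k\<in>UNIV. christoffel G i i k x * H k j x)
        - (\<Sum>k\<in>UNIV. christoffel G k i j x * H i k x)) = pd j R x / 2"
proof -
  have "pd j (divergence G (grad G u)) x = pd j R x"
    by (rule pd_cong[OF open_U x]) (rule divergence_grad_u)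
  moreover have "(\<Sum>l\<in>UNIV. ricci G j l x * grad G u x $ l) = - pd j R x / 2"
    by (simp add: pd_R[OF x])
  ultimately show ?thesis
    using contracted_ricci_identity[OF x, of "grad G u" j] x
    by (simp add: differentiable_grad_u differentiable_pd_grad_u)
qed

text \<open>The divergence of \<open>-2 H(grad u)\<close> is -2 (div H)(grad u) - 2 tr(H H). By
  \<open>divergence_H\<close> the former is -<dR, du>, and tr(H H) = |Ric|^2.\<close>

lemma laplacian_R:
  assumes x: "x \<in> U"
  shows "divergence G (grad G R) x
    = - (\<Sum>j\<in>UNIV. pd j R x * grad G u x $ j) - 2 * (\<Sum>i\<in>UNIV. \<Sum>j\<in>UNIV. H i j x * H j i x)"
proof -
  let ?w = "\<lambda>i. grad G u x $ i" and ?\<Gamma> = "\<lambda>l k i. christoffel G l k i x" and ?H = "\<lambda>i j. H i j x"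
  have 1: "pd i (\<lambda>y. grad G R y $ i) x = - 2 * ((\<Sum>j\<in>UNIV. pd i (H i j) x * ?w j)
      + (\<Sum>j\<in>UNIV. ?H i j * ?H j i) - (\<Sum>j\<in>UNIV. \<Sum>l\<in>UNIV. ?H i j * ?\<Gamma> j i l * ?w l))" for i
  proof -
    have "pd i (\<lambda>y. grad G R y $ i) x = pd i (\<lambda>y. - 2 * (\<Sum>j\<in>UNIV. H i j y * grad G u y $ j)) x"
      by (rule pd_cong[OF open_U x]) (rule grad_R)
    also have "\<dots> = - 2 * (\<Sum>j\<in>UNIV. pd i (H i j) x * ?w j + ?H i j * pd i (\<lambda>y. grad G u y $ j) x)"
      using x by (simp only: pd_cmult pd_sum pd_mult differentiable_grad_u differentiable_H
          differentiable_sum differentiable_mult finite_class.finite_UNIV ball_UNIV simp_thms)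
    also have "(\<Sum>j\<in>UNIV. pd i (H i j) x * ?w j + ?H i j * pd i (\<lambda>y. grad G u y $ j) x)
      = (\<Sum>j\<in>UNIV. pd i (H i j) x * ?w j)
      + (\<Sum>j\<in>UNIV. ?H i j * ?H j i) - (\<Sum>j\<in>UNIV. \<Sum>l\<in>UNIV. ?H i j * ?\<Gamma> j i l * ?w l)"
      unfolding pd_grad_u by (simp add: sum.distrib sum_subtractf right_diff_distrib sum_distrib_left mult.assoc)
    finally show ?thesis .
  qed
  have 2: "(\<Sum>k\<in>UNIV. ?\<Gamma> i i k * grad G R x $ k)
      = - 2 * (\<Sum>j\<in>UNIV. \<Sum>k\<in>UNIV. ?\<Gamma> i i k * ?H k j * ?w j)" for i
    unfolding grad_R[OF x]
    by (subst sum.swap) (simp add: sum_distrib_left mult_ac sum_negf)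
  \<comment> \<open>The Christoffel correction in the derivative of \<open>grad G u\<close> is
    exactly the lower-index connection term missing from div H.\<close>
  have 3: "(\<Sum>j\<in>UNIV. \<Sum>l\<in>UNIV. ?H i j * ?\<Gamma> j i l * ?w l)
      = (\<Sum>j\<in>UNIV. \<Sum>k\<in>UNIV. ?\<Gamma> k i j * ?H i k * ?w j)" for i
    by (subst sum.swap) (simp add: mult_ac)
  have "(\<Sum>j\<in>UNIV. pd j R x / 2 * ?w j) = (\<Sum>i\<in>UNIV. (\<Sum>j\<in>UNIV. pd i (H i j) x * ?w j)
       + (\<Sum>j\<in>UNIV. \<Sum>k\<in>UNIV. ?\<Gamma> i i k * ?H k j * ?w j)
       - (\<Sum>j\<in>UNIV. \<Sum>k\<in>UNIV. ?\<Gamma> k i j * ?H i k * ?w j))"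
    unfolding divergence_H[OF x, symmetric] sum_distrib_right
    by (subst sum.swap) (simp add: distrib_right left_diff_distrib sum_distrib_right sum.distrib sum_subtractf)
  moreover have "divergence G (grad G R) x = - 2 * (\<Sum>i\<in>UNIV. (\<Sum>j\<in>UNIV. pd i (H i j) x * ?w j)
       + (\<Sum>j\<in>UNIV. \<Sum>k\<in>UNIV. ?\<Gamma> i i k * ?H k j * ?w j)
       - (\<Sum>j\<in>UNIV. \<Sum>k\<in>UNIV. ?\<Gamma> k i j * ?H i k * ?w j)) - 2 * (\<Sum>i\<in>UNIV. \<Sum>j\<in>UNIV. ?H i j * ?H j i)"
    unfolding divergence_def 1 2 3 by (simp add: sum.distrib sum_subtractf sum_negf sum_distrib_left[symmetric])
  ultimately show ?thesis
    by (simp add: sum_divide_distrib[symmetric])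
qed

lemma divergence_identity:
  assumes x: "x \<in> U" and R1: "R x < 1"
  shows "(1 - R x) powr (3/2) *
     divergence G (\<lambda>y. (1 / sqrt (1 - R y)) *\<^sub>R grad G R y - (2 * sqrt (1 - R y)) *\<^sub>R grad G u y) x
    = - 2 * (1 - R x) * (\<Sum>i\<in>UNIV. \<Sum>j\<in>UNIV. H i j x * H j i x)
      + (\<Sum>i\<in>UNIV. pd i R x * grad G R x $ i) / 2 - 2 * R x * (1 - R x)\<^sup>2"
proof -
  define s where "s = sqrt (1 - R x)"
  have s: "s > 0" "1 - R x = s\<^sup>2"
    using R1 by (simp_all add: s_def)
  have d1: "((\<lambda>r. 1 / sqrt (1 - r)) has_real_derivative 1 / (2 * s ^ 3)) (at (R x))"
    by (rule derivative_eq_intros refl | use R1 s in \<open>simp add: s_def[symmetric] field_simps power2_eq_square power3_eq_cube\<close>)+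
  have d2: "((\<lambda>r. 2 * sqrt (1 - r)) has_real_derivative - (1 / s)) (at (R x))"
    by (rule derivative_eq_intros refl | use R1 s in \<open>simp add: s_def[symmetric] field_simps\<close>)+
  have "divergence G (\<lambda>y. (1 / sqrt (1 - R y)) *\<^sub>R grad G R y - (2 * sqrt (1 - R y)) *\<^sub>R grad G u y) x
    = 1 / s * divergence G (grad G R) x + (\<Sum>i\<in>UNIV. 1 / (2 * s ^ 3) * pd i R x * grad G R x $ i)
      - (2 * s * R x + (\<Sum>i\<in>UNIV. - (1 / s) * pd i R x * grad G u x $ i))"
  proof -
    note da = DERIV_differentiable[OF d1 differentiable_R[OF x]] DERIV_differentiable[OF d2 differentiable_R[OF x]]
    have c: "(\<lambda>y. ((1 / sqrt (1 - R y)) *\<^sub>R grad G R y) $ i) differentiable (at x)"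
      "(\<lambda>y. ((2 * sqrt (1 - R y)) *\<^sub>R grad G u y) $ i) differentiable (at x)" for i
      unfolding vector_scaleR_component real_scaleR_def
      by (intro differentiable_mult da differentiable_grad_R[OF x] differentiable_grad_u[OF x])+
    show ?thesis
      unfolding divergence_diff[OF c] divergence_scaleR[OF da(1) differentiable_grad_R[OF x]]
        divergence_scaleR[OF da(2) differentiable_grad_u[OF x]] pd_chain[OF d1 differentiable_R[OF x]]
        pd_chain[OF d2 differentiable_R[OF x]] divergence_grad_u[OF x] s_def ..
  qed
  \<comment> \<open>The Laplacian contributes -<dR, du>/s, and the derivative of the weight
    \<open>2 * sqrt (1 - R)\<close> contributes its opposite. The first-order terms thus cancel
    before multiplication by \<open>s ^ 3\<close>.\<close>
  also have "\<dots> = 1 / s * (- (\<Sum>i\<in>UNIV. pd i R x * grad G u x $ i) - 2 * (\<Sum>i\<in>UNIV. \<Sum>j\<in>UNIV. H i j x * H j i x))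
      + 1 / (2 * s ^ 3) * (\<Sum>i\<in>UNIV. pd i R x * grad G R x $ i)
      - 2 * s * R x + 1 / s * (\<Sum>i\<in>UNIV. pd i R x * grad G u x $ i)"
    unfolding laplacian_R[OF x] by (simp add: sum_distrib_left mult.assoc sum_negf)
  finally have div: "divergence G (\<lambda>y. (1 / sqrt (1 - R y)) *\<^sub>R grad G R y - (2 * sqrt (1 - R y)) *\<^sub>R grad G u y) x = \<dots>" .
  have "(1 - R x) powr (3/2) = s ^ 3"
  proof -
    have "(1 - R x) powr (3/2) = (s powr 2) powr (3/2)"
      using s by (simp add: powr_numeral)
    also have "\<dots> = s powr 3"
      by (simp add: powr_powr)
    finally show ?thesis
      using s by (simp add: powr_numeral)
  qed
  then show ?thesis
    unfolding div s(2) using s(1)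
    by (simp add: field_simps power2_eq_square power3_eq_cube)
qed

lemma D_tensor_norm:
  assumes x: "x \<in> U" and n: "CARD('n) \<ge> 3"
  shows "(real CARD('n) - 2)\<^sup>2 * tensor3_norm_sq G x (D_tensor G u x)
    + vec_norm_sq G x (grad G R x + (2 * R x) *\<^sub>R grad G u x) / (2 * (real CARD('n) - 1))
    = 2 * (1 - R x) * (\<Sum>i\<in>UNIV. \<Sum>j\<in>UNIV. H i j x * H j i x)
      - (\<Sum>i\<in>UNIV. pd i R x * grad G R x $ i) / 2"
proof -
  let ?n = "real CARD('n)"
  \<comment> \<open>This value makes D trace-free: contracting \<open>i\<close> with
    \<open>k\<close> in the alternated tensor leaves R du + dR/2 - \<kappa> (n - 1) w, where R du +
    dR/2 = w/2.\<close>
  define \<kappa> where "\<kappa> = 1 / (2 * (?n - 1))"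
  define w where "w i = pd i R x + 2 * R x * pd i u x" for i
  have n': "?n - 1 > 0" "?n - 2 > 0"
    using n by auto
  let ?P = "\<lambda>i j. ginv G x $ i $ j" and ?v = "\<lambda>i. pd i u x"
  have up: "(\<Sum>j\<in>UNIV. ?P i j * pd j h x) = grad G h x $ i" for i h
    by (simp add: grad_def)
  define ww where "ww i = grad G R x $ i + 2 * R x * grad G u x $ i" for i
  have ww: "(\<Sum>j\<in>UNIV. ?P i j * w j) = ww i" for i
    by (simp add: w_def ww_def grad_def distrib_left sum.distrib sum_distrib_left mult_ac)
  have b: "(\<Sum>i\<in>UNIV. ricci G k i x * grad G u x $ i) = - pd k R x / 2" for k
    by (simp add: pd_R[OF x])
  have Pb: "(\<Sum>j\<in>UNIV. ?P k j * (- pd j R x / 2)) = - grad G R x $ k / 2" for k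
    by (simp add: grad_def sum_negf sum_divide_distrib)
  have vv: "(\<Sum>j\<in>UNIV. ?v j * grad G u x $ j) = 1 - R x"
    using R_eq[OF x] by (simp add: mult.commute)
  have tr: "(\<Sum>i\<in>UNIV. H i i x) = R x"
    using divergence_grad_u[OF x] by (simp add: divergence_eq_cov_trace)
  have D: "D_tensor G u x = (\<lambda>i j k. 1 / (?n - 2) *
     ((ricci G i k x * ?v j - \<kappa> * (G x $ i $ k * w j)) - (ricci G j k x * ?v i - \<kappa> * (G x $ j $ k * w i))))"
  proof (intro ext)
    fix i j k
    define q where "q = 1 / (?n - 2)"
    have "1 / (2 * (?n - 1) * (?n - 2)) = q * \<kappa>"
      by (simp add: \<kappa>_def q_def)
    then show "D_tensor G u x i j k = 1 / (?n - 2) *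
       ((ricci G i k x * ?v j - \<kappa> * (G x $ i $ k * w j)) - (ricci G j k x * ?v i - \<kappa> * (G x $ j $ k * w i)))"
      unfolding D_tensor_def Let_def w_def q_def[symmetric] by (simp add: algebra_simps)
  qed
  have "(?n - 2)\<^sup>2 * tensor3_norm_sq G x (D_tensor G u x)
    = tensor3_norm_sq G x (\<lambda>i j k. (ricci G i k x * ?v j - \<kappa> * (G x $ i $ k * w j))
        - (ricci G j k x * ?v i - \<kappa> * (G x $ j $ k * w i)))"
    unfolding D tensor3_norm_sq_scale using n' by (simp add: power_divide)
  also have "\<dots> = 2 * (\<Sum>i\<in>UNIV. \<Sum>j\<in>UNIV. H i j x * H j i x) * (1 - R x)
      - 2 * (\<Sum>k\<in>UNIV. (- pd k R x / 2) * (- grad G R x $ k / 2))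
      + 4 * \<kappa> * ((\<Sum>k\<in>UNIV. (- pd k R x / 2) * ww k) - R x * (\<Sum>j\<in>UNIV. ?v j * ww j))
      + 2 * \<kappa>\<^sup>2 * (?n - 1) * (\<Sum>j\<in>UNIV. w j * ww j)"
    unfolding tensor3_norm_sq_alternated[OF x ricci_sym[OF x]] up ww b Pb vv H_eq[OF x, symmetric] tr ..
  \<comment> \<open>Since \<open>b\<close> is -dR/2, the covector b - R du is -w/2, so the terms
    linear in \<open>\<kappa>\<close> amount to -2 \<kappa> |w|^2. The quadratic term gives back
    \<kappa> |w|^2 by the choice of \<open>\<kappa>\<close>.\<close>
  also have "(\<Sum>k\<in>UNIV. (- pd k R x / 2) * ww k) - R x * (\<Sum>j\<in>UNIV. ?v j * ww j) = - (\<Sum>j\<in>UNIV. w j * ww j) / 2"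
  proof -
    have "(\<Sum>j\<in>UNIV. w j * ww j) = (\<Sum>j\<in>UNIV. pd j R x * ww j) + 2 * R x * (\<Sum>j\<in>UNIV. ?v j * ww j)"
      by (simp add: w_def distrib_right sum.distrib sum_distrib_left mult.assoc)
    moreover have "(\<Sum>k\<in>UNIV. (- pd k R x / 2) * ww k) = - (\<Sum>j\<in>UNIV. pd j R x * ww j) / 2"
      by (simp add: sum_negf sum_divide_distrib)
    ultimately show ?thesis
      by simp
  qed
  also have "2 * \<kappa>\<^sup>2 * (?n - 1) = \<kappa>"
  proof -
    have "2 * \<kappa> * (?n - 1) = 1"
      using n' by (simp add: \<kappa>_def)
    moreover have "2 * \<kappa>\<^sup>2 * (?n - 1) = \<kappa> * (2 * \<kappa> * (?n - 1))"
      by (simp add: power2_eq_square)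
    ultimately show ?thesis
      by simp
  qed
  also have "(\<Sum>k\<in>UNIV. (- pd k R x / 2) * (- grad G R x $ k / 2)) = (\<Sum>i\<in>UNIV. pd i R x * grad G R x $ i) / 4"
    by (simp add: sum_divide_distrib)
  finally have 1: "(?n - 2)\<^sup>2 * tensor3_norm_sq G x (D_tensor G u x)
    = 2 * (\<Sum>i\<in>UNIV. \<Sum>j\<in>UNIV. H i j x * H j i x) * (1 - R x)
      - (\<Sum>i\<in>UNIV. pd i R x * grad G R x $ i) / 2 - \<kappa> * (\<Sum>j\<in>UNIV. w j * ww j)"
    by simp
  have "vec_norm_sq G x (grad G R x + (2 * R x) *\<^sub>R grad G u x) = (\<Sum>j\<in>UNIV. w j * ww j)"
  proof -
    have "w j = (\<Sum>i\<in>UNIV. G x $ j $ i * ww i)" for j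
      unfolding w_def lower_grad[OF x, of j] ww_def
      by (simp add: distrib_left sum.distrib sum_distrib_left mult_ac)
    then show ?thesis
      by (simp add: vec_norm_sq_def inner_vec_def matrix_vector_mult_def ww_def mult.commute)
  qed
  then show ?thesis
    unfolding 1 by (simp add: \<kappa>_def algebra_simps)
qed

end

theorem lemma3:
  fixes X :: "'m topology"
    and A :: "('m, 'n::finite) chart set"
    and g :: "('m, 'n) metric_field"
    and f :: "'m \<Rightarrow> real"
  assumes "CARD('n) \<ge> 3"
    and "smooth_manifold X A"
    and "riemannian_metric A g"
    and "smooth_function A f"
    and soliton: "\<forall>c\<in>A. \<forall>x\<in>chart_image c. \<forall>i j.
          ricci (g c) i j x = hessian (g c) (coord_rep c f) i j x"
    and normalization: "\<forall>c\<in>A. \<forall>x\<in>chart_image c.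
          scalar_curvature (g c) x + vec_norm_sq (g c) x (grad (g c) (coord_rep c f) x) = 1"
  shows "\<forall>p\<in>topspace X. \<forall>c\<in>A. p \<in> fst c \<longrightarrow>
          (let n = real CARD('n); x = snd c p; G = g c; u = coord_rep c f;
               R = scalar_curvature G;
               V = (\<lambda>y. (1 / sqrt (1 - R y)) *\<^sub>R grad G R y - (2 * sqrt (1 - R y)) *\<^sub>R grad G u y)
           in R x < 1 \<longrightarrow>
              (1 - R x) powr (3/2) * divergence G V x =
                - ((n - 2)^2 * tensor3_norm_sq G x (D_tensor G u x))
                - vec_norm_sq G x (grad G R x + (2 * R x) *\<^sub>R grad G u x) / (2 * (n - 1))
                - 2 * R x * (1 - R x)^2)"
proof (intro ballI impI)
  fix p c
  assume c: "c \<in> A" and p: "p \<in> fst c"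
  define U where "U = chart_image c"
  define x where "x = snd c p"
  have x: "x \<in> U"
    using p by (simp add: U_def x_def chart_image_def)
  interpret steady_soliton_chart U "g c" "coord_rep c f"
  proof
    show "open U"
      using assms(2) c by (simp add: smooth_manifold_def U_def)
    show "smooth_on U (coord_rep c f)"
      using assms(4) c by (simp add: smooth_function_def U_def)
  qed (use assms(3) soliton normalization c in \<open>auto simp: riemannian_metric_def U_def\<close>)
  show "let n = real CARD('n); x = snd c p; G = g c; u = coord_rep c f;
               R = scalar_curvature G;
               V = (\<lambda>y. (1 / sqrt (1 - R y)) *\<^sub>R grad G R y - (2 * sqrt (1 - R y)) *\<^sub>R grad G u y)
           in R x < 1 \<longrightarrow>
              (1 - R x) powr (3/2) * divergence G V x =
                - ((n - 2)^2 * tensor3_norm_sq G x (D_tensor G u x))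
                - vec_norm_sq G x (grad G R x + (2 * R x) *\<^sub>R grad G u x) / (2 * (n - 1))
                - 2 * R x * (1 - R x)^2"
    \<comment> \<open>The terms in |Ric|^2 and |dR|^2 have opposite coefficients in the two
      identities, so the claim is a linear combination of them.\<close>
    unfolding Let_def x_def[symmetric]
    using divergence_identity[OF x] D_tensor_norm[OF x assms(1)] by (intro impI) linarith
qed

end
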